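(* Let $n,p,q$ be positive integers, and let $$\overline{\Delta_{\mathfrak m'}}=\prod_{\alpha\in\overline{\Phi_{\mathfrak m'}}}(1-e^{-\alpha}),\qquad \overline{\Phi_{\mathfrak m'}}=\{\epsilon_i-\epsilon_{p+n+j}:1\le i\le p,\ 1\le j\le q\}.$$ Then, as a character of $\mathfrak m'$, $$\overline{\Delta_{\mathfrak m'}}=\big(\mathrm{ch}\,\mathbb C[\mathrm M_{p,q}]\big)^{-1}.$$
   Context: Let $\mathfrak g'=\mathfrak{sl}_{n+p+q}(\mathbb C)$ with diagonal Cartan subalgebra $\mathfrak h$, diagonal coordinates $\epsilon_1,\dots,\epsilon_{n+p+q}$, and positive roots $\epsilon_i-\epsilon_j$ ($i<j$). Let $\mathfrak k'=\mathfrak s(\mathfrak{gl}_n\oplus\mathfrak{gl}_{p+q})$, with $\mathfrak{gl}_n$ in rows and columns $p+1,\dots,p+n$ and $\mathfrak{gl}_{p+q}$ in the remaining rows and columns. Compact roots are those whose root spaces lie in $\mathfrak k'$. Let $\mathfrak m'\subset\mathfrak k'$ be the Levi subalgebra $\mathfrak s(\mathfrak{gl}_n\oplus\mathfrak{gl}_p\oplus\mathfrak{gl}_q)$ of traceless block-diagonal matrices with diagonal blocks of sizes $p,n,q$ (in this order). Then $\overline{\Phi_{\mathfrak m'}}$ is the set of positive compact roots whose root spaces do not lie in $\mathfrak m'$. $\mathrm M_{p,q}$ is the space of complex $p\times q$ matrices, and $\mathbb C[\mathrm M_{p,q}]$ is its polynomial ring, on which $\mathrm{GL}_n\times\mathrm{GL}_p\times\mathrm{GL}_q$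 acts by $((g_n,g_p,g_q)\cdot f)(X)=f(g_p^TXg_q)$ (so $\mathrm{GL}_n$ acts trivially). To regard this as an $\mathfrak m'$-module, the $\mathfrak{gl}_p$ summand is embedded in the upper-left block via negative transpose: the block matrix $\mathrm{diag}(B_p,B_n,B_q)\in\mathfrak m'$ acts through the derived action of the element $(B_n,-B_p^T,B_q)\in\mathfrak{gl}_n\oplus\mathfrak{gl}_p\oplus\mathfrak{gl}_q$. For an $\mathfrak m'$-module $L$ that is a direct sum of finite-dimensional $\mathfrak h$-weight spaces $L_\xi$, $\mathrm{ch}\,L=\sum_{\xi}\dim(L_\xi)\,e^\xi$. Identities and inverses are in the ring of formal series in the $e^{-\alpha}$, $\alpha$ a positive root of $\mathfrak g'$. *)

theory Defs
  imports
    "HOL-Analysis.Analysis"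
    "HOL-Library.Function_Algebras"
    "Jordan_Normal_Form.Matrix"
begin

text \<open>Rows and columns are numbered from \<open>0\<close>.\<close>

definition tr :: "complex mat \<Rightarrow> complex" where
  "tr A = (\<Sum>i<dim_row A. A $$ (i, i))"

definition bracket :: "complex mat \<Rightarrow> complex mat \<Rightarrow> complex mat" where
  "bracket A B = A * B - B * A"

definition sl :: "nat \<Rightarrow> complex mat set" where
  "sl N = {A \<in> carrier_mat N N. tr A = 0}"

definition cartan :: "nat \<Rightarrow> complex mat set" where
  "cartan N = {H \<in> sl N. diagonal_mat H}"

definition alg_k :: "nat \<Rightarrow> nat \<Rightarrow> nat \<Rightarrow> complex mat set" where
  "alg_k n p q = {A \<in> sl (n + p + q). \<forall>i < n + p + q. \<forall>j < n + p + q.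
     A $$ (i, j) \<noteq> 0 \<longrightarrow> (i \<in> {p..<p + n} \<longleftrightarrow> j \<in> {p..<p + n})}"

definition alg_m :: "nat \<Rightarrow> nat \<Rightarrow> nat \<Rightarrow> complex mat set" where
  "alg_m n p q = {B. \<exists>Bp \<in> carrier_mat p p. \<exists>Bn \<in> carrier_mat n n. \<exists>Bq \<in> carrier_mat q q.
     B = diag_block_mat [Bp, Bn, Bq] \<and> tr B = 0}"

text \<open>An element of the dual of the Cartan subalgebra is represented by its extension by zero
  to all matrices; addition and negation are the pointwise operations.  Since the Cartan
  subalgebra is traceless, the sum of all \<open>eps N i\<close> is zero.\<close>

type_synonym weight = "complex mat \<Rightarrow> complex"

definition dual_cartan :: "nat \<Rightarrow> weight set" where
  "dual_cartan N = {\<xi>.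
     (\<forall>H. H \<notin> cartan N \<longrightarrow> \<xi> H = 0) \<and>
     (\<forall>H \<in> cartan N. \<forall>K \<in> cartan N. \<xi> (H + K) = \<xi> H + \<xi> K) \<and>
     (\<forall>H \<in> cartan N. \<forall>c. \<xi> (c \<cdot>\<^sub>m H) = c * \<xi> H)}"

definition eps :: "nat \<Rightarrow> nat \<Rightarrow> weight" where
  "eps N i = (\<lambda>H. if H \<in> cartan N then H $$ (i, i) else 0)"

definition pos_roots :: "nat \<Rightarrow> weight set" where
  "pos_roots N = {eps N i - eps N j | i j. i < j \<and> j < N}"

definition root_space :: "nat \<Rightarrow> weight \<Rightarrow> complex mat set" where
  "root_space N \<alpha> = {A \<in> sl N. \<forall>H \<in> cartan N. bracket H A = \<alpha> H \<cdot>\<^sub>m A}"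

definition compact_root :: "nat \<Rightarrow> nat \<Rightarrow> nat \<Rightarrow> weight \<Rightarrow> bool" where
  "compact_root n p q \<alpha> \<longleftrightarrow> root_space (n + p + q) \<alpha> \<subseteq> alg_k n p q"

definition Phi_bar :: "nat \<Rightarrow> nat \<Rightarrow> nat \<Rightarrow> weight set" where
  "Phi_bar n p q = {\<alpha> \<in> pos_roots (n + p + q).
     compact_root n p q \<alpha> \<and> \<not> root_space (n + p + q) \<alpha> \<subseteq> alg_m n p q}"

definition neg_cone :: "nat \<Rightarrow> weight set" where
  "neg_cone N = {\<xi>. \<exists>c :: weight \<Rightarrow> nat. \<forall>H. \<xi> H = - (\<Sum>\<alpha>\<in>pos_roots N. of_nat (c \<alpha>) * \<alpha> H)}"

text \<open>A series is given by its coefficient function; in the product below only finitely many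
  pairs contribute to each coefficient, because both supports lie in \<open>neg_cone N\<close>.\<close>

definition series_ring :: "nat \<Rightarrow> (weight \<Rightarrow> int) ring" where
  "series_ring N = \<lparr>
     carrier = {f. \<forall>\<xi>. f \<xi> \<noteq> 0 \<longrightarrow> \<xi> \<in> neg_cone N},
     monoid.mult = (\<lambda>f g \<xi>. \<Sum>(\<mu>, \<nu>) | f \<mu> \<noteq> 0 \<and> g \<nu> \<noteq> 0 \<and> \<mu> + \<nu> = \<xi>. f \<mu> * g \<nu>),
     one = (\<lambda>\<xi>. if \<xi> = 0 then 1 else 0),
     ring.zero = (\<lambda>\<xi>. 0),
     add = (\<lambda>f g \<xi>. f \<xi> + g \<xi>)\<rparr>"

definition fexp :: "weight \<Rightarrow> weight \<Rightarrow> int" where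
  "fexp \<xi> = (\<lambda>\<eta>. if \<eta> = \<xi> then 1 else 0)"

definition Delta_bar :: "nat \<Rightarrow> nat \<Rightarrow> nat \<Rightarrow> weight \<Rightarrow> int" where
  "Delta_bar n p q =
     (let R = series_ring (n + p + q)
      in finprod R (\<lambda>\<alpha>. \<one>\<^bsub>R\<^esub> \<ominus>\<^bsub>R\<^esub> fexp (- \<alpha>)) (Phi_bar n p q))"

definition cscale :: "complex \<Rightarrow> ('x \<Rightarrow> complex) \<Rightarrow> 'x \<Rightarrow> complex" where
  "cscale c f = (\<lambda>x. c * f x)"

global_interpretation cfun: vector_space "cscale :: complex \<Rightarrow> ('x \<Rightarrow> complex) \<Rightarrow> 'x \<Rightarrow> complex"
  by unfold_locales (auto simp: cscale_def fun_eq_iff algebra_simps)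

definition lie_module ::
  "complex mat set \<Rightarrow> ('x \<Rightarrow> complex) set \<Rightarrow> (complex mat \<Rightarrow> ('x \<Rightarrow> complex) \<Rightarrow> 'x \<Rightarrow> complex) \<Rightarrow> bool"
  where
  "lie_module g L \<rho> \<longleftrightarrow> cfun.subspace L \<and>
     (\<forall>A\<in>g. \<forall>v\<in>L. \<rho> A v \<in> L) \<and>
     (\<forall>A\<in>g. \<forall>v\<in>L. \<forall>w\<in>L. \<rho> A (v + w) = \<rho> A v + \<rho> A w) \<and>
     (\<forall>A\<in>g. \<forall>v\<in>L. \<forall>c. \<rho> A (cscale c v) = cscale c (\<rho> A v)) \<and>
     (\<forall>A\<in>g. \<forall>B\<in>g. \<forall>v\<in>L. \<rho> (A + B) v = \<rho> A v + \<rho> B v) \<and>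
     (\<forall>A\<in>g. \<forall>v\<in>L. \<forall>c. \<rho> (c \<cdot>\<^sub>m A) v = cscale c (\<rho> A v)) \<and>
     (\<forall>A\<in>g. \<forall>B\<in>g. \<forall>v\<in>L. \<rho> (bracket A B) v = \<rho> A (\<rho> B v) - \<rho> B (\<rho> A v))"

definition weight_space ::
  "nat \<Rightarrow> ('x \<Rightarrow> complex) set \<Rightarrow> (complex mat \<Rightarrow> ('x \<Rightarrow> complex) \<Rightarrow> 'x \<Rightarrow> complex)
     \<Rightarrow> weight \<Rightarrow> ('x \<Rightarrow> complex) set"
  where
  "weight_space N L \<rho> \<xi> = {v \<in> L. \<forall>H \<in> cartan N. \<rho> H v = cscale (\<xi> H) v}"

text \<open>Finite-dimensionality is required explicitly because \<open>cfun.dim\<close> is \<open>0\<close> on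
  infinite-dimensional spaces.\<close>

definition has_weight_decomposition ::
  "nat \<Rightarrow> ('x \<Rightarrow> complex) set \<Rightarrow> (complex mat \<Rightarrow> ('x \<Rightarrow> complex) \<Rightarrow> 'x \<Rightarrow> complex) \<Rightarrow> bool"
  where
  "has_weight_decomposition N L \<rho> \<longleftrightarrow>
     (\<forall>\<xi> \<in> dual_cartan N. \<exists>B. finite B \<and> weight_space N L \<rho> \<xi> \<subseteq> cfun.span B) \<and>
     (\<forall>v \<in> L. \<exists>!c :: weight \<Rightarrow> 'x \<Rightarrow> complex.
        (\<forall>\<xi> \<in> dual_cartan N. c \<xi> \<in> weight_space N L \<rho> \<xi>) \<and>
        (\<forall>\<xi>. \<xi> \<notin> dual_cartan N \<longrightarrow> c \<xi> = 0) \<and>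
        finite {\<xi>. c \<xi> \<noteq> 0} \<and>
        v = (\<Sum>\<xi> | c \<xi> \<noteq> 0. c \<xi>))"

definition ch ::
  "nat \<Rightarrow> ('x \<Rightarrow> complex) set \<Rightarrow> (complex mat \<Rightarrow> ('x \<Rightarrow> complex) \<Rightarrow> 'x \<Rightarrow> complex) \<Rightarrow> weight \<Rightarrow> int"
  where
  "ch N L \<rho> = (\<lambda>\<xi>. if \<xi> \<in> dual_cartan N then int (cfun.dim (weight_space N L \<rho> \<xi>)) else 0)"

text \<open>Polynomials are identified with polynomial functions (the field is infinite), which are
  extended by zero outside \<open>carrier_mat p q\<close>.\<close>

inductive_set poly_M :: "nat \<Rightarrow> nat \<Rightarrow> (complex mat \<Rightarrow> complex) set" for p q where
  const: "(\<lambda>X. if X \<in> carrier_mat p q then c else 0) \<in> poly_M p q"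
| coord: "i < p \<Longrightarrow> j < q \<Longrightarrow> (\<lambda>X. if X \<in> carrier_mat p q then X $$ (i, j) else 0) \<in> poly_M p q"
| add: "f \<in> poly_M p q \<Longrightarrow> g \<in> poly_M p q \<Longrightarrow> (\<lambda>X. f X + g X) \<in> poly_M p q"
| mult: "f \<in> poly_M p q \<Longrightarrow> g \<in> poly_M p q \<Longrightarrow> (\<lambda>X. f X * g X) \<in> poly_M p q"

fun group_action ::
  "nat \<Rightarrow> nat \<Rightarrow> complex mat \<times> complex mat \<times> complex mat \<Rightarrow> (complex mat \<Rightarrow> complex)
     \<Rightarrow> complex mat \<Rightarrow> complex"
  where
  "group_action p q (gn, gp, gq) f =
     (\<lambda>X. if X \<in> carrier_mat p q then f (transpose_mat gp * X * gq) else 0)"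

text \<open>The derived action is the differential at the identity of \<open>g \<mapsto> g \<cdot> f\<close>.  It is computed
  along the curve \<open>1 + t A\<close>, which is invertible for small \<open>t\<close> and has velocity \<open>A\<close> at \<open>t = 0\<close>,
  as does \<open>exp (t A)\<close>.\<close>

fun derived_action ::
  "nat \<Rightarrow> nat \<Rightarrow> nat \<Rightarrow> complex mat \<times> complex mat \<times> complex mat \<Rightarrow> (complex mat \<Rightarrow> complex)
     \<Rightarrow> complex mat \<Rightarrow> complex"
  where
  "derived_action n p q (An, Ap, Aq) f =
     (\<lambda>X. deriv (\<lambda>t. group_action p q
        (1\<^sub>m n + t \<cdot>\<^sub>m An, 1\<^sub>m p + t \<cdot>\<^sub>m Ap, 1\<^sub>m q + t \<cdot>\<^sub>m Aq) f X) 0)"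

definition diag_block :: "nat \<Rightarrow> nat \<Rightarrow> complex mat \<Rightarrow> complex mat" where
  "diag_block s k B = mat k k (\<lambda>(i, j). B $$ (s + i, s + j))"

definition m_action ::
  "nat \<Rightarrow> nat \<Rightarrow> nat \<Rightarrow> complex mat \<Rightarrow> (complex mat \<Rightarrow> complex) \<Rightarrow> complex mat \<Rightarrow> complex" where
  "m_action n p q B = derived_action n p q
     (diag_block p n B, - transpose_mat (diag_block 0 p B), diag_block (p + n) q B)"

end

theory Submission
  imports Defs
begin

text \<open>The traceless diagonal matrices act on the coordinate function \<open>x\<^sub>i\<^sub>j\<close> through the
negated root \<open>-(\<epsilon>\<^sub>i - \<epsilon>\<^bsub>p+n+j\<^esub>)\<close>: the left factor of the group enters through a negative
transpose and contributes \<open>-\<epsilon>\<^sub>i\<close>, the right factor contributes \<open>\<epsilon>\<^bsub>p+n+j\<^esub>\<close>.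
Monomials are therefore weight vectors, they form a basis of the polynomial ring, and the
multiplicity of a weight \<open>\<xi>\<close> is the number of multisets of index pairs whose weights add up to
\<open>\<xi>\<close> (\<open>ch_poly_M\<close>).  The character is thus the generating function of vector partitions
\<open>\<Prod> (1 + e\<^bsup>-\<alpha>\<^esup> + e\<^bsup>-2\<alpha>\<^esup> + \<dots>)\<close> over \<open>\<alpha> = \<epsilon>\<^sub>i - \<epsilon>\<^bsub>p+n+j\<^esub>\<close>, and the identity is the
geometric series, one root at a time (\<open>partition_count_inverse\<close>).

Three further points have to be settled.  The series ring must be a commutative ring although its
elements may have infinite support; this holds because the supports lie in a cone generated by
finitely many elements of height at least \<open>1\<close>, so that only finitely many pairs of exponents
contribute to a coefficient.  The derived action is a differential, computed along a curve; every
derivation of the polynomial ring is determined by its values on coordinates, and this turns all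
identities between operators, in particular the bracket relation, into identities of matrices.
Finally, linear independence of monomials as functions and uniqueness of weight decompositions are
instances of one statement: joint eigenvectors of a family of operators with distinct eigenvalue systems are independent
(\<open>joint_eigenvectors_independent\<close>), applied to the operators doubling one matrix entry in the
first case and to the Cartan subalgebra in the second.\<close>

section \<open>Formal series supported in a pointed cone\<close>

lemma finite_bounded_multisets:
  assumes "finite K"
  shows "finite {M. set_mset M \<subseteq> K \<and> size M \<le> r}"
proof -
  have "{M. set_mset M \<subseteq> K \<and> size M \<le> r} \<subseteq> mset ` {xs. set xs \<subseteq> K \<and> length xs \<le> r}"
  proof
    fix M assume "M \<in> {M. set_mset M \<subseteq> K \<and> size M \<le> r}"
    moreover obtain xs where "M = mset xs" by (metis ex_mset)
    ultimately show "M \<in> mset ` {xs. set xs \<subseteq> K \<and> length xs \<le> r}" by auto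
  qed
  then show ?thesis
    by (rule finite_subset) (simp add: finite_lists_length_le assms)
qed

text \<open>The vector partition function of the family \<open>b\<close>.  A multiset of indices rather than of
vectors is counted, so that it also enumerates monomials in variables indexed by \<open>K\<close>.\<close>
definition partition_count :: "('k \<Rightarrow> 'w::comm_monoid_add) \<Rightarrow> 'k set \<Rightarrow> 'w \<Rightarrow> int" where
  "partition_count b K \<xi> = int (card {M. set_mset M \<subseteq> K \<and> (\<Sum>k\<in>#M. b k) = \<xi>})"

text \<open>The weights at hand are negated sums of positive roots.  All finiteness comes from one additive
height that is at least \<open>1\<close> on each of the finitely many generators: a sum of generators of
given height has a bounded number of terms.\<close>
locale graded_cone =
  fixes G :: "'w::ab_group_add set" and ht :: "'w \<Rightarrow> real"
  assumes finite_gens: "finite G"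
    and ht_add: "ht (x + y) = ht x + ht y"
    and ht_gens: "g \<in> G \<Longrightarrow> 1 \<le> ht g"
begin

definition cone :: "'w set" where
  "cone = sum_mset ` {M. set_mset M \<subseteq> G}"

text \<open>The first components of the decompositions of \<open>\<xi>\<close> into two elements of the cone, over which
products of series are summed.\<close>
definition below :: "'w \<Rightarrow> 'w set" where
  "below \<xi> = {\<mu> \<in> cone. \<xi> - \<mu> \<in> cone}"

text \<open>The product sums over pairs of support points, as in \<open>series_ring\<close>, so that the latter is an
instance by unfolding; \<open>mult_series\<close> replaces it by a sum over a finite set independent of the
factors.\<close>
definition cone_series :: "('w \<Rightarrow> int) ring" where
  "cone_series = \<lparr>
     carrier = {f. \<forall>\<xi>. f \<xi> \<noteq> 0 \<longrightarrow> \<xi> \<in> cone},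
     monoid.mult = (\<lambda>f g \<xi>. \<Sum>(\<mu>, \<nu>) | f \<mu> \<noteq> 0 \<and> g \<nu> \<noteq> 0 \<and> \<mu> + \<nu> = \<xi>. f \<mu> * g \<nu>),
     one = (\<lambda>\<xi>. if \<xi> = 0 then 1 else 0),
     ring.zero = (\<lambda>\<xi>. 0),
     add = (\<lambda>f g \<xi>. f \<xi> + g \<xi>)\<rparr>"

lemma ht_zero [simp]: "ht 0 = 0"
  using ht_add[of 0 0] by simp

lemma cone_zero [simp]: "0 \<in> cone"
  unfolding cone_def by (rule image_eqI[of _ _ "{#}"]) auto

lemma cone_add: "x \<in> cone \<Longrightarrow> y \<in> cone \<Longrightarrow> x + y \<in> cone"
proof -
  assume "x \<in> cone" "y \<in> cone"
  then obtain M N where "x = sum_mset M" "y = sum_mset N" "set_mset M \<subseteq> G" "set_mset N \<subseteq> G"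
    unfolding cone_def by blast
  then show ?thesis
    unfolding cone_def by (intro image_eqI[of _ _ "M + N"]) auto
qed

lemma gens_in_cone: "g \<in> G \<Longrightarrow> g \<in> cone"
  unfolding cone_def by (rule image_eqI[of _ _ "{#g#}"]) auto

lemma size_le_ht:
  assumes "\<And>k. k \<in># M \<Longrightarrow> b k \<in> G"
  shows "real (size M) \<le> ht (\<Sum>k\<in>#M. b k)"
  using assms
proof (induction M)
  case (add x M)
  then show ?case using ht_gens[of "b x"] by (simp add: ht_add)
qed simp

lemma size_le_ht': "set_mset M \<subseteq> G \<Longrightarrow> real (size M) \<le> ht (sum_mset M)"
  using size_le_ht[of M "\<lambda>x. x"] by auto

lemma finite_partitions:
  assumes "finite K" "b ` K \<subseteq> G"
  shows "finite {M. set_mset M \<subseteq> K \<and> (\<Sum>k\<in>#M. b k) = \<xi>}"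
proof (rule finite_subset[OF _ finite_bounded_multisets[OF assms(1), of "nat \<lfloor>ht \<xi>\<rfloor>"]])
  show "{M. set_mset M \<subseteq> K \<and> (\<Sum>k\<in>#M. b k) = \<xi>} \<subseteq> {M. set_mset M \<subseteq> K \<and> size M \<le> nat \<lfloor>ht \<xi>\<rfloor>}"
  proof safe
    fix M assume M: "set_mset M \<subseteq> K" "\<xi> = (\<Sum>k\<in>#M. b k)"
    have "real (size M) \<le> ht (\<Sum>k\<in>#M. b k)" by (rule size_le_ht) (use M(1) assms in auto)
    then show "size M \<le> nat \<lfloor>ht (\<Sum>k\<in>#M. b k)\<rfloor>" by linarith
  qed
qed

text \<open>In \<open>\<xi> = \<mu> + (\<xi> - \<mu>)\<close> both heights are nonnegative, so the height of \<open>\<xi>\<close> bounds the number of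
generators in \<open>\<mu>\<close>.\<close>
lemma finite_below: "finite (below \<xi>)"
proof (rule finite_subset)
  show "below \<xi> \<subseteq> sum_mset ` {M. set_mset M \<subseteq> G \<and> size M \<le> nat \<lfloor>ht \<xi>\<rfloor>}"
  proof
    fix \<mu> assume "\<mu> \<in> below \<xi>"
    then obtain M N where M: "\<mu> = sum_mset M" "set_mset M \<subseteq> G"
      and N: "\<xi> - \<mu> = sum_mset N" "set_mset N \<subseteq> G"
      unfolding below_def cone_def by blast
    have "ht \<xi> = ht \<mu> + ht (\<xi> - \<mu>)" by (simp flip: ht_add)
    then have "size M \<le> nat \<lfloor>ht \<xi>\<rfloor>"
      using size_le_ht'[OF M(2), folded M(1)] size_le_ht'[OF N(2), folded N(1)] by linarith
    then show "\<mu> \<in> sum_mset ` {M. set_mset M \<subseteq> G \<and> size M \<le> nat \<lfloor>ht \<xi>\<rfloor>}"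
      using M by blast
  qed
  show "finite (sum_mset ` {M. set_mset M \<subseteq> G \<and> size M \<le> nat \<lfloor>ht \<xi>\<rfloor>})"
    using finite_bounded_multisets[OF finite_gens] by blast
qed

lemma below_sym: "\<mu> \<in> below \<xi> \<Longrightarrow> \<xi> - \<mu> \<in> below \<xi>"
  by (auto simp: below_def)

lemma carrier_series_iff: "f \<in> carrier cone_series \<longleftrightarrow> (\<forall>\<xi>. f \<xi> \<noteq> 0 \<longrightarrow> \<xi> \<in> cone)"
  by (simp add: cone_series_def)

lemma add_series [simp]: "(f \<oplus>\<^bsub>cone_series\<^esub> g) \<xi> = f \<xi> + g \<xi>"
  by (simp add: cone_series_def)

lemma zero_series [simp]: "\<zero>\<^bsub>cone_series\<^esub> \<xi> = 0"
  by (simp add: cone_series_def)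

lemma one_series: "\<one>\<^bsub>cone_series\<^esub> \<xi> = (if \<xi> = 0 then 1 else 0)"
  by (simp add: cone_series_def)

lemma mult_series:
  assumes "f \<in> carrier cone_series" "g \<in> carrier cone_series"
  shows "(f \<otimes>\<^bsub>cone_series\<^esub> g) \<xi> = (\<Sum>\<mu>\<in>below \<xi>. f \<mu> * g (\<xi> - \<mu>))"
proof -
  let ?S = "{(\<mu>, \<nu>). f \<mu> \<noteq> 0 \<and> g \<nu> \<noteq> 0 \<and> \<mu> + \<nu> = \<xi>}"
  let ?T = "{\<mu> \<in> below \<xi>. f \<mu> \<noteq> 0 \<and> g (\<xi> - \<mu>) \<noteq> 0}"
  have "(f \<otimes>\<^bsub>cone_series\<^esub> g) \<xi> = (\<Sum>(\<mu>, \<nu>)\<in>?S. f \<mu> * g \<nu>)"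
    by (simp add: cone_series_def)
  also have "\<dots> = (\<Sum>\<mu>\<in>?T. f \<mu> * g (\<xi> - \<mu>))"
    by (rule sum.reindex_bij_witness[of _ "\<lambda>\<mu>. (\<mu>, \<xi> - \<mu>)" fst])
      (use assms in \<open>auto simp: below_def carrier_series_iff\<close>)
  also have "\<dots> = (\<Sum>\<mu>\<in>below \<xi>. f \<mu> * g (\<xi> - \<mu>))"
    by (rule sum.mono_neutral_left) (auto simp: finite_below)
  finally show ?thesis .
qed

lemma mult_closed:
  assumes "f \<in> carrier cone_series" "g \<in> carrier cone_series"
  shows "f \<otimes>\<^bsub>cone_series\<^esub> g \<in> carrier cone_series"
  unfolding carrier_series_iff
proof (intro allI impI)
  fix \<xi> assume "(f \<otimes>\<^bsub>cone_series\<^esub> g) \<xi> \<noteq> 0"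
  then obtain \<mu> where "\<mu> \<in> below \<xi>"
    unfolding mult_series[OF assms] by (meson sum.not_neutral_contains_not_neutral)
  then show "\<xi> \<in> cone" using cone_add[of \<mu> "\<xi> - \<mu>"] by (simp add: below_def)
qed

lemma add_closed:
  assumes "f \<in> carrier cone_series" "g \<in> carrier cone_series"
  shows "f \<oplus>\<^bsub>cone_series\<^esub> g \<in> carrier cone_series"
  unfolding carrier_series_iff
proof (intro allI impI)
  fix \<xi> assume "(f \<oplus>\<^bsub>cone_series\<^esub> g) \<xi> \<noteq> 0"
  then have "f \<xi> \<noteq> 0 \<or> g \<xi> \<noteq> 0" by auto
  then show "\<xi> \<in> cone" using assms by (auto simp: carrier_series_iff)
qed

lemma zero_closed: "\<zero>\<^bsub>cone_series\<^esub> \<in> carrier cone_series"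
  by (simp add: carrier_series_iff)

lemma one_closed: "\<one>\<^bsub>cone_series\<^esub> \<in> carrier cone_series"
  by (simp add: carrier_series_iff one_series)

lemma mult_comm:
  assumes "f \<in> carrier cone_series" "g \<in> carrier cone_series"
  shows "f \<otimes>\<^bsub>cone_series\<^esub> g = g \<otimes>\<^bsub>cone_series\<^esub> f"
proof
  fix \<xi>
  show "(f \<otimes>\<^bsub>cone_series\<^esub> g) \<xi> = (g \<otimes>\<^bsub>cone_series\<^esub> f) \<xi>"
    unfolding mult_series[OF assms] mult_series[OF assms(2,1)]
    by (rule sum.reindex_bij_witness[of _ "\<lambda>\<mu>. \<xi> - \<mu>" "\<lambda>\<mu>. \<xi> - \<mu>"])
      (auto simp: below_sym mult.commute)
qed

text \<open>Both sides sum over the decompositions of \<open>\<xi>\<close> into three elements of the cone; the two nested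
sums differ by the change of variables \<open>(\<mu>, \<nu>) \<leftrightarrow> (\<nu>, \<mu> - \<nu>)\<close>.\<close>
lemma mult_assoc:
  assumes f: "f \<in> carrier cone_series" and g: "g \<in> carrier cone_series"
    and h: "h \<in> carrier cone_series"
  shows "(f \<otimes>\<^bsub>cone_series\<^esub> g) \<otimes>\<^bsub>cone_series\<^esub> h = f \<otimes>\<^bsub>cone_series\<^esub> (g \<otimes>\<^bsub>cone_series\<^esub> h)"
proof
  fix \<xi>
  have "((f \<otimes>\<^bsub>cone_series\<^esub> g) \<otimes>\<^bsub>cone_series\<^esub> h) \<xi>
      = (\<Sum>\<mu>\<in>below \<xi>. \<Sum>\<nu>\<in>below \<mu>. f \<nu> * g (\<mu> - \<nu>) * h (\<xi> - \<mu>))"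
    by (simp add: mult_series mult_closed f g h sum_distrib_right)
  also have "\<dots> = (\<Sum>(\<mu>, \<nu>)\<in>(SIGMA \<mu>:below \<xi>. below \<mu>). f \<nu> * g (\<mu> - \<nu>) * h (\<xi> - \<mu>))"
    by (rule sum.Sigma) (auto simp: finite_below)
  also have "\<dots> = (\<Sum>(\<nu>, \<kappa>)\<in>(SIGMA \<nu>:below \<xi>. below (\<xi> - \<nu>)). f \<nu> * (g \<kappa> * h (\<xi> - \<nu> - \<kappa>)))"
  proof (rule sum.reindex_bij_witness[of _ "\<lambda>(\<nu>, \<kappa>). (\<nu> + \<kappa>, \<nu>)" "\<lambda>(\<mu>, \<nu>). (\<nu>, \<mu> - \<nu>)"]; clarsimp)
    fix \<mu> \<nu> assume "\<mu> \<in> below \<xi>" "\<nu> \<in> below \<mu>"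
    then show "\<nu> \<in> below \<xi> \<and> \<mu> - \<nu> \<in> below (\<xi> - \<nu>)"
      using cone_add[of "\<xi> - \<mu>" "\<mu> - \<nu>"] by (simp add: below_def)
  next
    fix \<nu> \<kappa> assume "\<nu> \<in> below \<xi>" "\<kappa> \<in> below (\<xi> - \<nu>)"
    then show "\<nu> + \<kappa> \<in> below \<xi> \<and> \<nu> \<in> below (\<nu> + \<kappa>)"
      using cone_add[of \<nu> \<kappa>] by (simp add: below_def algebra_simps)
  qed
  also have "\<dots> = (\<Sum>\<nu>\<in>below \<xi>. \<Sum>\<kappa>\<in>below (\<xi> - \<nu>). f \<nu> * (g \<kappa> * h (\<xi> - \<nu> - \<kappa>)))"
    by (rule sum.Sigma[symmetric]) (auto simp: finite_below)
  also have "\<dots> = (f \<otimes>\<^bsub>cone_series\<^esub> (g \<otimes>\<^bsub>cone_series\<^esub> h)) \<xi>"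
    by (simp add: mult_series mult_closed f g h sum_distrib_left)
  finally show "((f \<otimes>\<^bsub>cone_series\<^esub> g) \<otimes>\<^bsub>cone_series\<^esub> h) \<xi>
      = (f \<otimes>\<^bsub>cone_series\<^esub> (g \<otimes>\<^bsub>cone_series\<^esub> h)) \<xi>" .
qed

lemma one_mult:
  assumes "f \<in> carrier cone_series"
  shows "\<one>\<^bsub>cone_series\<^esub> \<otimes>\<^bsub>cone_series\<^esub> f = f"
proof
  fix \<xi>
  have "(\<one>\<^bsub>cone_series\<^esub> \<otimes>\<^bsub>cone_series\<^esub> f) \<xi> = (\<Sum>\<mu>\<in>below \<xi>. if \<mu> = 0 then f \<xi> else 0)"
    unfolding mult_series[OF one_closed assms] by (rule sum.cong) (auto simp: one_series)
  also have "\<dots> = f \<xi>"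
    using assms by (subst sum.delta[OF finite_below]) (auto simp: carrier_series_iff below_def)
  finally show "(\<one>\<^bsub>cone_series\<^esub> \<otimes>\<^bsub>cone_series\<^esub> f) \<xi> = f \<xi>" .
qed

lemma cring_series: "cring cone_series"
proof (rule cringI)
  show "abelian_group cone_series"
  proof (rule abelian_groupI)
    fix f assume f: "f \<in> carrier cone_series"
    show "\<exists>g\<in>carrier cone_series. g \<oplus>\<^bsub>cone_series\<^esub> f = \<zero>\<^bsub>cone_series\<^esub>"
      by (rule bexI[of _ "\<lambda>\<xi>. - f \<xi>"]) (use f in \<open>auto simp: carrier_series_iff fun_eq_iff\<close>)
  qed (auto simp: add_closed fun_eq_iff zero_closed)
  show "comm_monoid cone_series"
    by (rule comm_monoidI) (auto intro: mult_closed one_closed mult_assoc one_mult mult_comm)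
  fix f g h assume c: "f \<in> carrier cone_series" "g \<in> carrier cone_series" "h \<in> carrier cone_series"
  from c(1,2) have "f \<oplus>\<^bsub>cone_series\<^esub> g \<in> carrier cone_series" by (rule add_closed)
  with c show "(f \<oplus>\<^bsub>cone_series\<^esub> g) \<otimes>\<^bsub>cone_series\<^esub> h
      = f \<otimes>\<^bsub>cone_series\<^esub> h \<oplus>\<^bsub>cone_series\<^esub> g \<otimes>\<^bsub>cone_series\<^esub> h"
    by (auto simp: fun_eq_iff mult_series distrib_right sum.distrib)
qed

sublocale series: cring cone_series
  by (rule cring_series)

lemma uminus_series:
  assumes "f \<in> carrier cone_series"
  shows "(\<ominus>\<^bsub>cone_series\<^esub> f) = (\<lambda>\<xi>. - f \<xi>)"
  by (rule series.minus_equality) (use assms in \<open>auto simp: carrier_series_iff fun_eq_iff\<close>)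

definition exp_series :: "'w \<Rightarrow> 'w \<Rightarrow> int" where
  "exp_series b = (\<lambda>\<eta>. if \<eta> = b then 1 else 0)"

lemma exp_closed: "b \<in> cone \<Longrightarrow> exp_series b \<in> carrier cone_series"
  by (auto simp: exp_series_def carrier_series_iff)

lemma factor_closed:
  "b \<in> cone \<Longrightarrow> \<one>\<^bsub>cone_series\<^esub> \<ominus>\<^bsub>cone_series\<^esub> exp_series b \<in> carrier cone_series"
  by (simp add: exp_closed)

text \<open>The only decompositions that matter are \<open>0 + \<xi>\<close> and \<open>b + (\<xi> - b)\<close>.  If \<open>\<xi> - b\<close> is
outside the cone, the second one is absent and \<open>f (\<xi> - b)\<close> vanishes as well.\<close>
lemma mult_factor:
  assumes f: "f \<in> carrier cone_series" and b: "b \<in> cone"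
  shows "((\<one>\<^bsub>cone_series\<^esub> \<ominus>\<^bsub>cone_series\<^esub> exp_series b) \<otimes>\<^bsub>cone_series\<^esub> f) \<xi> = f \<xi> - f (\<xi> - b)"
proof -
  have "(exp_series b \<otimes>\<^bsub>cone_series\<^esub> f) \<xi> = (\<Sum>\<mu>\<in>below \<xi>. if \<mu> = b then f (\<xi> - b) else 0)"
    unfolding mult_series[OF exp_closed[OF b] f]
    by (rule sum.cong) (auto simp: exp_series_def)
  also have "\<dots> = f (\<xi> - b)"
    using f b by (subst sum.delta[OF finite_below]) (auto simp: carrier_series_iff below_def)
  finally have *: "(exp_series b \<otimes>\<^bsub>cone_series\<^esub> f) \<xi> = f (\<xi> - b)" .
  have "(\<one>\<^bsub>cone_series\<^esub> \<ominus>\<^bsub>cone_series\<^esub> exp_series b) \<otimes>\<^bsub>cone_series\<^esub> f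
      = f \<oplus>\<^bsub>cone_series\<^esub> (\<ominus>\<^bsub>cone_series\<^esub> (exp_series b \<otimes>\<^bsub>cone_series\<^esub> f))"
    using f exp_closed[OF b]
    by (simp add: series.minus_eq series.l_distr series.l_minus)
  then show ?thesis
    using f exp_closed[OF b] * by (simp add: uminus_series)
qed

lemma partition_count_closed:
  assumes "b ` K \<subseteq> G"
  shows "partition_count b K \<in> carrier cone_series"
  unfolding carrier_series_iff
proof (intro allI impI)
  fix \<xi> assume "partition_count b K \<xi> \<noteq> 0"
  then have "card {M. set_mset M \<subseteq> K \<and> (\<Sum>k\<in>#M. b k) = \<xi>} \<noteq> 0" by (simp add: partition_count_def)
  then obtain M where "set_mset M \<subseteq> K" "(\<Sum>k\<in>#M. b k) = \<xi>"
    by (metis (mono_tags, lifting) Collect_empty_eq card.empty)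
  with assms show "\<xi> \<in> cone"
    unfolding cone_def by (intro image_eqI[of _ _ "image_mset b M"]) auto
qed

text \<open>A partition either avoids the part \<open>a\<close> or arises from a partition of \<open>\<xi> - b a\<close> by adding
one copy of \<open>a\<close>.  This is the coefficientwise form of
\<open>1 / (1 - e\<^bsup>b\<^esup>) = 1 + e\<^bsup>b\<^esup> / (1 - e\<^bsup>b\<^esup>)\<close>.\<close>
lemma partition_count_recurrence:
  assumes K: "finite (insert a K)" "a \<notin> K" and b: "b ` insert a K \<subseteq> G"
  shows "partition_count b (insert a K) \<xi>
    = partition_count b K \<xi> + partition_count b (insert a K) (\<xi> - b a)"
proof -
  let ?P = "\<lambda>K \<xi>. {M. set_mset M \<subseteq> K \<and> (\<Sum>k\<in>#M. b k) = \<xi>}"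
  have "?P (insert a K) \<xi> = ?P K \<xi> \<union> add_mset a ` ?P (insert a K) (\<xi> - b a)" (is "?A = ?B")
  proof
    show "?A \<subseteq> ?B"
    proof
      fix M assume M: "M \<in> ?A"
      show "M \<in> ?B"
      proof (cases "a \<in># M")
        case True
        then obtain N where "M = add_mset a N" by (metis multi_member_split)
        with M show ?thesis by auto
      next
        case False
        with M show ?thesis by auto
      qed
    qed
  qed auto
  moreover have "?P K \<xi> \<inter> add_mset a ` ?P (insert a K) (\<xi> - b a) = {}"
  proof -
    have "add_mset a N \<notin> ?P K \<xi>" for N using K(2) by simp
    then show ?thesis by blast
  qed
  moreover have "finite (?P K \<xi>)" "finite (?P (insert a K) (\<xi> - b a))"
    by (rule finite_partitions; use K b in auto)+
  ultimately show ?thesis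
    unfolding partition_count_def by (simp add: card_Un_disjoint card_image inj_on_def)
qed

text \<open>By the recurrence, multiplication with the factor for \<open>a\<close> removes the part \<open>a\<close> from the
generating function; removing all parts leaves only the empty partition.\<close>
theorem partition_count_inverse:
  assumes "finite K" "b ` K \<subseteq> G"
  shows "finprod cone_series (\<lambda>k. \<one>\<^bsub>cone_series\<^esub> \<ominus>\<^bsub>cone_series\<^esub> exp_series (b k)) K
      \<otimes>\<^bsub>cone_series\<^esub> partition_count b K = \<one>\<^bsub>cone_series\<^esub>"
  using assms
proof (induction K)
  case empty
  have "{M. M = {#} \<and> (\<Sum>k\<in>#M. b k) = \<xi>} = (if \<xi> = 0 then {{#}} else {})" for \<xi>
    by auto
  then have "partition_count b {} = \<one>\<^bsub>cone_series\<^esub>"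
    by (auto simp: partition_count_def one_series fun_eq_iff)
  then show ?case by simp
next
  case (insert a K)
  let ?F = "\<lambda>k. \<one>\<^bsub>cone_series\<^esub> \<ominus>\<^bsub>cone_series\<^esub> exp_series (b k)"
  have F: "?F k \<in> carrier cone_series" if "k \<in> insert a K" for k
    using that insert.prems by (intro factor_closed gens_in_cone) auto
  have ba: "b a \<in> cone" using insert.prems by (simp add: gens_in_cone)
  have P: "partition_count b (insert a K) \<in> carrier cone_series"
    "partition_count b K \<in> carrier cone_series"
    using insert.prems by (auto intro!: partition_count_closed)
  have step: "?F a \<otimes>\<^bsub>cone_series\<^esub> partition_count b (insert a K) = partition_count b K"
  proof
    fix \<xi>
    show "(?F a \<otimes>\<^bsub>cone_series\<^esub> partition_count b (insert a K)) \<xi> = partition_count b K \<xi>"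
      unfolding mult_factor[OF P(1) ba]
      using partition_count_recurrence[of a K b \<xi>] insert by simp
  qed
  have fp: "finprod cone_series ?F K \<in> carrier cone_series"
    by (rule series.finprod_closed) (use F in auto)
  have "finprod cone_series ?F (insert a K) = ?F a \<otimes>\<^bsub>cone_series\<^esub> finprod cone_series ?F K"
    by (rule series.finprod_insert) (use F insert.hyps in auto)
  also have "\<dots> = finprod cone_series ?F K \<otimes>\<^bsub>cone_series\<^esub> ?F a"
    by (rule series.m_comm) (use F fp in auto)
  finally have "finprod cone_series ?F (insert a K) \<otimes>\<^bsub>cone_series\<^esub> partition_count b (insert a K)
      = finprod cone_series ?F K \<otimes>\<^bsub>cone_series\<^esub> (?F a \<otimes>\<^bsub>cone_series\<^esub> partition_count b (insert a K))"
    using series.m_assoc[OF fp F[of a] P(1)] by simp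
  also have "\<dots> = \<one>\<^bsub>cone_series\<^esub>" unfolding step using insert by simp
  finally show ?case .
qed

end

section \<open>Roots and root spaces of the special linear algebra\<close>

lemma sum_fun_apply: "(\<Sum>a\<in>A. f a) x = (\<Sum>a\<in>A. f a x)"
  by (induction A rule: infinite_finite_induct) auto

text \<open>Subtracting the mean makes any diagonal traceless without changing differences of entries, which
are all that roots see.\<close>
definition traceless_diag :: "nat \<Rightarrow> (nat \<Rightarrow> complex) \<Rightarrow> complex mat" where
  "traceless_diag N d = mat N N (\<lambda>(i, j). if i = j then d i - (\<Sum>k<N. d k) / of_nat N else 0)"

lemma traceless_diag_in_cartan: "traceless_diag N d \<in> cartan N"
  by (cases "N = 0")
    (auto simp: traceless_diag_def cartan_def sl_def tr_def diagonal_mat_def sum_subtractf)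

lemma cartan_carrier: "H \<in> cartan N \<Longrightarrow> H \<in> carrier_mat N N"
  by (auto simp: cartan_def sl_def)

lemma eps_cartan: "H \<in> cartan N \<Longrightarrow> eps N i H = H $$ (i, i)"
  by (simp add: eps_def)

lemma root_traceless_diag:
  assumes "i < N" "j < N"
  shows "(eps N i - eps N j) (traceless_diag N d) = d i - d j"
  unfolding fun_diff_def eps_cartan[OF traceless_diag_in_cartan]
  using assms by (simp add: traceless_diag_def)

text \<open>Evaluation at the diagonal matrix units, made traceless, separates roots: the value at the \<open>k\<close>-th
one is \<open>1\<close>, \<open>-1\<close> or \<open>0\<close> according to whether \<open>k\<close> is the first, the second or neither
index.\<close>
lemma root_determines_indices:
  assumes "a < N" "b < N" "i < N" "j < N" "i \<noteq> j"
    and eq: "\<And>H. H \<in> cartan N \<Longrightarrow> H $$ (a, a) - H $$ (b, b) = H $$ (i, i) - H $$ (j, j)"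
  shows "a = i \<and> b = j"
proof -
  have *: "(if a = k then 1 else 0) - (if b = k then 1 else 0)
      = ((if i = k then 1 else 0) - (if j = k then 1 else 0) :: complex)" for k
    using eq[OF traceless_diag_in_cartan[of N "\<lambda>l. if l = k then 1 else 0"]] assms(1-4)
    by (simp add: traceless_diag_def)
  show ?thesis using *[of i] *[of j] \<open>i \<noteq> j\<close> by (auto split: if_splits)
qed

lemma root_eq_iff:
  assumes "a < N" "b < N" "i < N" "j < N" "i \<noteq> j"
  shows "eps N a - eps N b = eps N i - eps N j \<longleftrightarrow> a = i \<and> b = j"
proof
  assume eq: "eps N a - eps N b = eps N i - eps N j"
  show "a = i \<and> b = j"
  proof (rule root_determines_indices[OF assms])
    fix H assume "H \<in> cartan N"
    then show "H $$ (a, a) - H $$ (b, b) = H $$ (i, i) - H $$ (j, j)"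
      using fun_cong[OF eq, of H] by (simp add: eps_cartan)
  qed
qed simp

lemma diagonal_mult_entry:
  assumes "H \<in> cartan N" "A \<in> carrier_mat N N" "a < N" "b < N"
  shows "(H * A) $$ (a, b) = H $$ (a, a) * A $$ (a, b)"
    and "(A * H) $$ (a, b) = A $$ (a, b) * H $$ (b, b)"
proof -
  have H: "H \<in> carrier_mat N N" "\<And>k l. k < N \<Longrightarrow> l < N \<Longrightarrow> k \<noteq> l \<Longrightarrow> H $$ (k, l) = 0"
    using assms(1) by (auto simp: cartan_def sl_def diagonal_mat_def)
  have "(H * A) $$ (a, b) = (\<Sum>k\<in>{0..<N}. H $$ (a, k) * A $$ (k, b))"
    using H(1) assms by (simp add: scalar_prod_def)
  also have "\<dots> = (\<Sum>k\<in>{0..<N}. if k = a then H $$ (a, a) * A $$ (a, b) else 0)"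
    by (rule sum.cong) (use H(2)[of a] assms in auto)
  finally show "(H * A) $$ (a, b) = H $$ (a, a) * A $$ (a, b)" using assms by simp
  have "(A * H) $$ (a, b) = (\<Sum>k\<in>{0..<N}. A $$ (a, k) * H $$ (k, b))"
    using H(1) assms by (simp add: scalar_prod_def)
  also have "\<dots> = (\<Sum>k\<in>{0..<N}. if k = b then A $$ (a, b) * H $$ (b, b) else 0)"
    by (rule sum.cong) (use H(2)[of _ b] assms in auto)
  finally show "(A * H) $$ (a, b) = A $$ (a, b) * H $$ (b, b)" using assms by simp
qed

lemma root_space_iff:
  "A \<in> root_space N (eps N i - eps N j) \<longleftrightarrow> A \<in> sl N \<and>
    (\<forall>H\<in>cartan N. \<forall>a<N. \<forall>b<N.
      (H $$ (a, a) - H $$ (b, b)) * A $$ (a, b) = (H $$ (i, i) - H $$ (j, j)) * A $$ (a, b))"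
proof -
  have "bracket H A = (eps N i - eps N j) H \<cdot>\<^sub>m A \<longleftrightarrow> (\<forall>a<N. \<forall>b<N.
      (H $$ (a, a) - H $$ (b, b)) * A $$ (a, b) = (H $$ (i, i) - H $$ (j, j)) * A $$ (a, b))"
    if "A \<in> sl N" "H \<in> cartan N" for H
  proof -
    have c: "A \<in> carrier_mat N N" "H \<in> carrier_mat N N"
      using that by (auto simp: cartan_def sl_def)
    have "(bracket H A) $$ (a, b) = (H $$ (a, a) - H $$ (b, b)) * A $$ (a, b)" if "a < N" "b < N" for a b
      using diagonal_mult_entry[OF \<open>H \<in> cartan N\<close> c(1) that] c that
      by (simp add: bracket_def algebra_simps)
    moreover have "bracket H A \<in> carrier_mat N N" 
      unfolding bracket_def using c by (intro minus_carrier_mat mult_carrier_mat)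
    ultimately show ?thesis
      using c by (auto simp: mat_eq_iff eps_cartan[OF that(2)])
  qed
  then show ?thesis unfolding root_space_def by blast
qed

text \<open>A nonzero entry \<open>(a, b)\<close> forces the root to coincide with \<open>\<epsilon>\<^sub>a - \<epsilon>\<^sub>b\<close>.  Together with the
matrix unit below, the root space is exactly the line of that matrix unit, so that its inclusion in
a block subalgebra depends on the position of one entry.\<close>
lemma root_space_support:
  assumes "A \<in> root_space N (eps N i - eps N j)" "A $$ (a, b) \<noteq> 0"
    and "a < N" "b < N" "i < N" "j < N" "i \<noteq> j"
  shows "a = i \<and> b = j"
  by (rule root_determines_indices[OF assms(3-7)]) (use assms in \<open>auto simp: root_space_iff\<close>)

lemma matrix_unit_in_root_space:
  assumes "i < N" "j < N" "i \<noteq> j"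
  shows "mat N N (\<lambda>(a, b). if a = i \<and> b = j then 1 else 0) \<in> root_space N (eps N i - eps N j)"
  using assms by (auto simp: root_space_iff sl_def tr_def intro!: sum.neutral)

text \<open>Numbers the diagonal blocks of sizes \<open>p\<close>, \<open>n\<close>, \<open>q\<close> from \<open>0\<close>.\<close>
definition block :: "nat \<Rightarrow> nat \<Rightarrow> nat \<Rightarrow> nat" where
  "block n p i = (if i < p then 0 else if i < p + n then 1 else 2)"

lemma diag_block_mat_entry:
  assumes "Bp \<in> carrier_mat p p" "Bn \<in> carrier_mat n n" "Bq \<in> carrier_mat q q"
    and "i < n + p + q" "j < n + p + q"
  shows "diag_block_mat [Bp, Bn, Bq] $$ (i, j) =
    (if block n p i \<noteq> block n p j then 0
     else if i < p then Bp $$ (i, j)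
     else if i < p + n then Bn $$ (i - p, j - p)
     else Bq $$ (i - p - n, j - p - n))"
  using assms by (auto simp: block_def Let_def)

lemma alg_m_iff:
  "B \<in> alg_m n p q \<longleftrightarrow> B \<in> sl (n + p + q) \<and>
    (\<forall>i < n + p + q. \<forall>j < n + p + q. B $$ (i, j) \<noteq> 0 \<longrightarrow> block n p i = block n p j)"
proof
  assume "B \<in> alg_m n p q"
  then obtain Bp Bn Bq where c: "Bp \<in> carrier_mat p p" "Bn \<in> carrier_mat n n" "Bq \<in> carrier_mat q q"
    and B: "B = diag_block_mat [Bp, Bn, Bq]" "tr B = 0"
    unfolding alg_m_def by blast
  have "B \<in> carrier_mat (n + p + q) (n + p + q)"
    unfolding B(1) by (rule carrier_matI) (use c in \<open>simp_all add: dim_diag_block_mat del: diag_block_mat.simps\<close>)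
  then show "B \<in> sl (n + p + q) \<and>
    (\<forall>i < n + p + q. \<forall>j < n + p + q. B $$ (i, j) \<noteq> 0 \<longrightarrow> block n p i = block n p j)"
    using B(2) diag_block_mat_entry[OF c] unfolding sl_def B(1) by auto
next
  assume B: "B \<in> sl (n + p + q) \<and>
    (\<forall>i < n + p + q. \<forall>j < n + p + q. B $$ (i, j) \<noteq> 0 \<longrightarrow> block n p i = block n p j)"
  then have dim: "B \<in> carrier_mat (n + p + q) (n + p + q)" and tr: "tr B = 0" by (auto simp: sl_def)
  have c: "diag_block 0 p B \<in> carrier_mat p p" "diag_block p n B \<in> carrier_mat n n"
    "diag_block (p + n) q B \<in> carrier_mat q q" by (auto simp: diag_block_def)
  have "B = diag_block_mat [diag_block 0 p B, diag_block p n B, diag_block (p + n) q B]" (is "_ = ?D")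
  proof (rule eq_matI)
    show "dim_row B = dim_row ?D" "dim_col B = dim_col ?D"
      using dim by (auto simp: dim_diag_block_mat diag_block_def simp del: diag_block_mat.simps)
    fix i j assume "i < dim_row ?D" "j < dim_col ?D"
    then have ij: "i < n + p + q" "j < n + p + q"
      by (auto simp: dim_diag_block_mat diag_block_def simp del: diag_block_mat.simps)
    show "B $$ (i, j) = ?D $$ (i, j)"
    proof (cases "block n p i = block n p j")
      case True
      then consider "i < p" "j < p" | "p \<le> i" "i < p + n" "p \<le> j" "j < p + n"
        | "p + n \<le> i" "p + n \<le> j"
        unfolding block_def by (auto split: if_splits)
      then show ?thesis
        unfolding diag_block_mat_entry[OF c ij]
        by cases (use ij in \<open>simp_all add: diag_block_def block_def\<close>)
    next
      case False
      then have "B $$ (i, j) = 0" using B ij by blast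
      with False show ?thesis unfolding diag_block_mat_entry[OF c ij] by simp
    qed
  qed
  then show "B \<in> alg_m n p q" unfolding alg_m_def using c tr by blast
qed

lemma root_space_in_alg_k_iff:
  assumes "i < n + p + q" "j < n + p + q" "i \<noteq> j"
  shows "root_space (n + p + q) (eps (n + p + q) i - eps (n + p + q) j) \<subseteq> alg_k n p q
    \<longleftrightarrow> (i \<in> {p..<p + n} \<longleftrightarrow> j \<in> {p..<p + n})" (is "?L \<longleftrightarrow> ?R")
proof
  assume ?L
  then have "mat (n + p + q) (n + p + q) (\<lambda>(a, b). if a = i \<and> b = j then 1 else 0) \<in> alg_k n p q"
    using matrix_unit_in_root_space[OF assms] by (rule subsetD)
  then show ?R
    unfolding alg_k_def mem_Collect_eq using assms by (auto dest!: spec[of _ i] spec[of _ j])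
next
  assume ?R
  then show ?L
    using root_space_support[OF _ _ _ _ assms] unfolding alg_k_def root_space_def by blast
qed

lemma root_space_in_alg_m_iff:
  assumes "i < n + p + q" "j < n + p + q" "i \<noteq> j"
  shows "root_space (n + p + q) (eps (n + p + q) i - eps (n + p + q) j) \<subseteq> alg_m n p q
    \<longleftrightarrow> block n p i = block n p j" (is "?L \<longleftrightarrow> ?R")
proof
  assume ?L
  then have "mat (n + p + q) (n + p + q) (\<lambda>(a, b). if a = i \<and> b = j then 1 else 0) \<in> alg_m n p q"
    using matrix_unit_in_root_space[OF assms] by (rule subsetD)
  then show ?R
    unfolding alg_m_iff mem_Collect_eq using assms by (auto dest!: spec[of _ i] spec[of _ j])
next
  assume ?R
  then show ?L
    using root_space_support[OF _ _ _ _ assms] unfolding alg_m_iff subset_iff root_space_def by blast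
qed

text \<open>A compact root joins two indices that are both inside or both outside the middle block.  If they
lie in different blocks, the blocks must be the two outer ones, and positivity decides the order.\<close>
lemma Phi_bar_eq:
  "Phi_bar n p q = {eps (n + p + q) i - eps (n + p + q) (p + n + j) | i j. i < p \<and> j < q}"
proof -
  let ?r = "\<lambda>i j. eps (n + p + q) i - eps (n + p + q) j"
  have *: "(?r i j \<in> Phi_bar n p q) \<longleftrightarrow> i < p \<and> p + n \<le> j" if "i < j" "j < n + p + q" for i j
  proof -
    have "?r i j \<in> pos_roots (n + p + q)" unfolding pos_roots_def using that by blast
    then show ?thesis
      using root_space_in_alg_k_iff[of i n p q j] root_space_in_alg_m_iff[of i n p q j] that
      by (auto simp: Phi_bar_def compact_root_def block_def)
  qed
  show ?thesis
  proof (intro equalityI subsetI)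
    fix \<alpha> assume \<alpha>: "\<alpha> \<in> Phi_bar n p q"
    then obtain i j where ij: "\<alpha> = ?r i j" "i < j" "j < n + p + q"
      unfolding Phi_bar_def pos_roots_def by blast
    with \<alpha> * have "i < p" "p + n \<le> j" by auto
    then show "\<alpha> \<in> {?r i (p + n + j) | i j. i < p \<and> j < q}"
      using ij by (intro CollectI exI[of _ i] exI[of _ "j - (p + n)"]) auto
  next
    fix \<alpha> assume "\<alpha> \<in> {?r i (p + n + j) | i j. i < p \<and> j < q}"
    then obtain i j where "\<alpha> = ?r i (p + n + j)" "i < p" "j < q" by blast
    then show "\<alpha> \<in> Phi_bar n p q" using *[of i "p + n + j"] by auto
  qed
qed

lemma finite_pos_roots: "finite (pos_roots N)"
proof -
  have "pos_roots N \<subseteq> (\<lambda>(i, j). eps N i - eps N j) ` ({..<N} \<times> {..<N})"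
    unfolding pos_roots_def by auto
  then show ?thesis by (rule finite_subset) simp
qed

text \<open>Evaluation at the negative of the half sum of the positive coroots: \<open>-(\<epsilon>\<^sub>i - \<epsilon>\<^sub>j)\<close> has
height \<open>j - i\<close>.\<close>
definition height :: "nat \<Rightarrow> weight \<Rightarrow> real" where
  "height N \<xi> = Re (\<xi> (traceless_diag N of_nat))"

lemma graded_cone_neg_roots: "graded_cone (uminus ` pos_roots N) (height N)"
proof
  show "finite (uminus ` pos_roots N)" using finite_pos_roots by blast
  show "height N (x + y) = height N x + height N y" for x y by (simp add: height_def)
  fix g assume "g \<in> uminus ` pos_roots N"
  then obtain i j where "g = - (eps N i - eps N j)" "i < j" "j < N"
    unfolding pos_roots_def by blast
  moreover from this have "height N g = real j - real i"
    using root_traceless_diag[of i N j of_nat] unfolding height_def by (simp del: minus_diff_eq)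
  ultimately show "1 \<le> height N g" by simp
qed

text \<open>Multiplicities of roots are traded for multisets of negated roots.\<close>
lemma neg_cone_eq: "neg_cone N = graded_cone.cone (uminus ` pos_roots N)"
proof -
  interpret graded_cone "uminus ` pos_roots N" "height N" by (rule graded_cone_neg_roots)
  show ?thesis
  proof (intro equalityI subsetI)
    fix \<xi> assume "\<xi> \<in> neg_cone N"
    then obtain c :: "weight \<Rightarrow> nat" where c: "\<And>H. \<xi> H = - (\<Sum>\<alpha>\<in>pos_roots N. of_nat (c \<alpha>) * \<alpha> H)"
      unfolding neg_cone_def by blast
    have mult: "of_nat k * - \<alpha> \<in> cone" if "\<alpha> \<in> pos_roots N" for \<alpha> k
    proof (induction k)
      case (Suc k)
      have "- \<alpha> \<in> cone" using that by (intro gens_in_cone) blast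
      then have "- \<alpha> + of_nat k * - \<alpha> \<in> cone" using Suc by (rule cone_add)
      also have "- \<alpha> + of_nat k * - \<alpha> = of_nat (Suc k) * - \<alpha>"
        by (simp add: fun_eq_iff algebra_simps)
      finally show ?case .
    next
      case 0
      have "of_nat 0 * - \<alpha> = (0 :: weight)" by (simp add: fun_eq_iff)
      then show ?case by (simp only: cone_zero)
    qed
    have sums: "A \<subseteq> pos_roots N \<Longrightarrow> (\<Sum>\<alpha>\<in>A. of_nat (c \<alpha>) * - \<alpha>) \<in> cone" if "finite A" for A
      using that
    proof (induction A)
      case (insert x A)
      then have x: "x \<in> pos_roots N" and A: "A \<subseteq> pos_roots N" by simp_all
      show ?case
        unfolding sum.insert[OF insert.hyps] by (rule cone_add[OF mult[OF x] insert.IH[OF A]])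
    qed simp
    have "\<xi> = (\<Sum>\<alpha>\<in>pos_roots N. of_nat (c \<alpha>) * - \<alpha>)"
      by (rule ext) (simp add: c sum_fun_apply sum_negf)
    then show "\<xi> \<in> cone" using sums[OF finite_pos_roots] by simp
  next
    fix \<xi> assume "\<xi> \<in> cone"
    then obtain M where M: "\<xi> = sum_mset M" "set_mset M \<subseteq> uminus ` pos_roots N"
      unfolding cone_def by blast
    from M(2) have "sum_mset M \<in> neg_cone N"
    proof (induction M)
      case empty
      then show ?case unfolding neg_cone_def by (intro CollectI exI[of _ "\<lambda>_. 0"]) simp
    next
      case (add g M)
      then have "g \<in> uminus ` pos_roots N" and M: "sum_mset M \<in> neg_cone N"
        unfolding set_mset_add_mset_insert insert_subset by blast+
      then obtain \<beta> where \<beta>: "g = - \<beta>" "\<beta> \<in> pos_roots N" by blast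
      from M obtain c :: "weight \<Rightarrow> nat"
        where c: "\<And>H. sum_mset M H = - (\<Sum>\<alpha>\<in>pos_roots N. of_nat (c \<alpha>) * \<alpha> H)"
        unfolding neg_cone_def by blast
      have "sum_mset (add_mset g M) H
          = - (\<Sum>\<alpha>\<in>pos_roots N. of_nat ((c(\<beta> := Suc (c \<beta>))) \<alpha>) * \<alpha> H)" for H
        by (simp add: c \<beta> sum.remove[OF finite_pos_roots \<beta>(2)] algebra_simps)
      then show ?case unfolding neg_cone_def by blast
    qed
    with M show "\<xi> \<in> neg_cone N" by simp
  qed
qed

lemma series_ring_eq: "series_ring N = graded_cone.cone_series (uminus ` pos_roots N)"
proof -
  interpret graded_cone "uminus ` pos_roots N" "height N" by (rule graded_cone_neg_roots)
  show ?thesis unfolding series_ring_def cone_series_def neg_cone_eq ..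
qed

section \<open>The polynomial ring as a module of derivations\<close>

abbreviation poly_const :: "nat \<Rightarrow> nat \<Rightarrow> complex \<Rightarrow> complex mat \<Rightarrow> complex" where
  "poly_const p q c \<equiv> (\<lambda>X. if X \<in> carrier_mat p q then c else 0)"

abbreviation coord :: "nat \<Rightarrow> nat \<Rightarrow> nat \<Rightarrow> nat \<Rightarrow> complex mat \<Rightarrow> complex" where
  "coord p q i j \<equiv> (\<lambda>X. if X \<in> carrier_mat p q then X $$ (i, j) else 0)"

lemma poly_M_outside: "f \<in> poly_M p q \<Longrightarrow> X \<notin> carrier_mat p q \<Longrightarrow> f X = 0"
  by (induction rule: poly_M.induct) auto

lemma subspace_poly_M: "cfun.subspace (poly_M p q)"
proof (rule cfun.subspaceI)
  show "0 \<in> poly_M p q" using poly_M.const[of p q 0] by (simp add: zero_fun_def)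
  show "f + g \<in> poly_M p q" if "f \<in> poly_M p q" "g \<in> poly_M p q" for f g
    using poly_M.add[OF that] by (simp add: plus_fun_def)
  show "cscale c f \<in> poly_M p q" if "f \<in> poly_M p q" for c f
  proof -
    have "cscale c f = (\<lambda>X. poly_const p q c X * f X)"
      using poly_M_outside[OF that] by (auto simp: cscale_def fun_eq_iff)
    then show ?thesis using poly_M.mult[OF poly_M.const that, of c] by simp
  qed
qed

definition derivation :: "nat \<Rightarrow> nat \<Rightarrow> ((complex mat \<Rightarrow> complex) \<Rightarrow> complex mat \<Rightarrow> complex) \<Rightarrow> bool" where
  "derivation p q D \<longleftrightarrow>
     (\<forall>f\<in>poly_M p q. D f \<in> poly_M p q) \<and>
     (\<forall>c. D (poly_const p q c) = 0) \<and>
     (\<forall>f\<in>poly_M p q. \<forall>g\<in>poly_M p q. D (\<lambda>X. f X + g X) = (\<lambda>X. D f X + D g X)) \<and>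
     (\<forall>f\<in>poly_M p q. \<forall>g\<in>poly_M p q. D (\<lambda>X. f X * g X) = (\<lambda>X. D f X * g X + f X * D g X))"

lemma derivation_closed: "derivation p q D \<Longrightarrow> f \<in> poly_M p q \<Longrightarrow> D f \<in> poly_M p q"
  by (simp add: derivation_def)

lemma derivation_const: "derivation p q D \<Longrightarrow> D (poly_const p q c) = 0"
  by (simp add: derivation_def)

lemma derivation_add:
  "derivation p q D \<Longrightarrow> f \<in> poly_M p q \<Longrightarrow> g \<in> poly_M p q \<Longrightarrow> D (f + g) = D f + D g"
  by (simp add: derivation_def plus_fun_def)

lemma derivation_mult:
  "derivation p q D \<Longrightarrow> f \<in> poly_M p q \<Longrightarrow> g \<in> poly_M p q \<Longrightarrow>
    D (\<lambda>X. f X * g X) = (\<lambda>X. D f X * g X + f X * D g X)"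
  by (simp add: derivation_def)

text \<open>Constants and coordinates generate the polynomial ring, so a derivation is determined on
coordinates.  This is how all identities between the operators of the action are proved.\<close>
lemma derivation_eqI:
  assumes D: "derivation p q D" and E: "derivation p q E"
    and coords: "\<And>i j. i < p \<Longrightarrow> j < q \<Longrightarrow> D (coord p q i j) = E (coord p q i j)"
    and f: "f \<in> poly_M p q"
  shows "D f = E f"
  using f
proof (induction rule: poly_M.induct)
  case (const c)
  then show ?case by (simp only: derivation_const[OF D] derivation_const[OF E])
next
  case (coord i j)
  then show ?case by (rule coords)
next
  case (add f g)
  then show ?case
    using derivation_add[OF D add.hyps] derivation_add[OF E add.hyps] by (simp add: plus_fun_def)
next
  case (mult f g)
  then show ?case
    by (simp only: derivation_mult[OF D mult.hyps] derivation_mult[OF E mult.hyps])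
qed

lemma derivation_scale:
  assumes "derivation p q D" "f \<in> poly_M p q"
  shows "D (cscale c f) = cscale c (D f)"
proof -
  have "cscale c f = (\<lambda>X. poly_const p q c X * f X)"
    using poly_M_outside[OF assms(2)] by (auto simp: cscale_def fun_eq_iff)
  then have "D (cscale c f) = (\<lambda>X. poly_const p q c X * D f X)"
    using derivation_mult[OF assms(1) poly_M.const assms(2), of c] derivation_const[OF assms(1)]
    by simp
  also have "\<dots> = cscale c (D f)"
    using poly_M_outside[OF derivation_closed[OF assms]] by (auto simp: cscale_def fun_eq_iff)
  finally show ?thesis .
qed

lemma derivation_linear_combination:
  assumes D: "derivation p q D" and f: "\<And>l. l \<in> S \<Longrightarrow> f l \<in> poly_M p q"
  shows "D (\<Sum>l\<in>S. cscale (c l) (f l)) = (\<Sum>l\<in>S. cscale (c l) (D (f l)))"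
  using f
proof (induction S rule: infinite_finite_induct)
  case (insert x S)
  have "(\<Sum>l\<in>S. cscale (c l) (f l)) \<in> poly_M p q" "cscale (c x) (f x) \<in> poly_M p q"
    using insert by (auto intro!: cfun.subspace_sum cfun.subspace_scale subspace_poly_M)
  then have eq: "D (cscale (c x) (f x) + (\<Sum>l\<in>S. cscale (c l) (f l)))
      = cscale (c x) (D (f x)) + D (\<Sum>l\<in>S. cscale (c l) (f l))"
    using derivation_add[OF D] derivation_scale[OF D, of "f x"] insert.prems by simp
  have IH: "D (\<Sum>l\<in>S. cscale (c l) (f l)) = (\<Sum>l\<in>S. cscale (c l) (D (f l)))"
    by (rule insert.IH) (use insert.prems in auto)
  show ?case by (simp only: sum.insert[OF insert.hyps] eq IH)
qed (use derivation_const[OF D, of 0] in \<open>auto simp: zero_fun_def\<close>)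

lemma derivation_sum:
  assumes "derivation p q D" "derivation p q E"
  shows "derivation p q (\<lambda>f. D f + E f)"
  unfolding derivation_def
  using assms
  by (auto simp: derivation_closed derivation_const derivation_mult fun_eq_iff algebra_simps
      derivation_add[unfolded plus_fun_def] intro!: cfun.subspace_add[OF subspace_poly_M])

lemma derivation_multiple:
  assumes "derivation p q D"
  shows "derivation p q (\<lambda>f. cscale c (D f))"
  unfolding derivation_def
  using assms
  by (auto simp: derivation_closed derivation_const derivation_mult fun_eq_iff algebra_simps
      derivation_add[unfolded plus_fun_def] cscale_def[of _ "0::'b \<Rightarrow> _"] intro!: cfun.subspace_scale[OF subspace_poly_M])
    (auto simp: cscale_def algebra_simps)

text \<open>The mixed terms \<open>D f * E g\<close> and \<open>E f * D g\<close> cancel.\<close>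
lemma derivation_commutator:
  assumes D: "derivation p q D" and E: "derivation p q E"
  shows "derivation p q (\<lambda>f. D (E f) - E (D f))"
  unfolding derivation_def
proof (intro conjI ballI allI)
  fix f g assume f: "f \<in> poly_M p q" and g: "g \<in> poly_M p q"
  note cl = derivation_closed[OF D] derivation_closed[OF E] f g poly_M.mult
  show "D (E f) - E (D f) \<in> poly_M p q"
    by (intro cfun.subspace_diff[OF subspace_poly_M] cl)
  show "D (E (\<lambda>X. f X + g X)) - E (D (\<lambda>X. f X + g X))
      = (\<lambda>X. (D (E f) - E (D f)) X + (D (E g) - E (D g)) X)"
    by (simp add: derivation_add[unfolded plus_fun_def, OF D] derivation_add[unfolded plus_fun_def, OF E]
        cl fun_eq_iff)
  show "D (E (\<lambda>X. f X * g X)) - E (D (\<lambda>X. f X * g X))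
      = (\<lambda>X. (D (E f) - E (D f)) X * g X + f X * (D (E g) - E (D g)) X)"
    by (simp add: derivation_add[unfolded plus_fun_def, OF D] derivation_add[unfolded plus_fun_def, OF E]
        derivation_mult[OF D] derivation_mult[OF E] cl fun_eq_iff algebra_simps)
next
  fix c
  have "D 0 = 0" "E 0 = 0"
    using derivation_const[OF D, of 0] derivation_const[OF E, of 0] by (auto simp: zero_fun_def)
  then show "D (E (poly_const p q c)) - E (D (poly_const p q c)) = 0"
    by (simp add: derivation_const[OF D] derivation_const[OF E])
qed

text \<open>The path \<open>t \<mapsto> g\<^sub>p\<^sup>T X g\<^sub>q\<close> through \<open>X\<close> along which the derived action differentiates, after
the two transpositions have cancelled; its velocity at \<open>0\<close> follows.\<close>
definition action_curve :: "nat \<Rightarrow> nat \<Rightarrow> nat \<Rightarrow> complex mat \<Rightarrow> complex mat \<Rightarrow> complex \<Rightarrow> complex mat" where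
  "action_curve n p q B X t =
     (1\<^sub>m p - t \<cdot>\<^sub>m diag_block 0 p B) * X * (1\<^sub>m q + t \<cdot>\<^sub>m diag_block (p + n) q B)"

definition action_velocity :: "nat \<Rightarrow> nat \<Rightarrow> nat \<Rightarrow> complex mat \<Rightarrow> complex mat \<Rightarrow> complex mat" where
  "action_velocity n p q B X = X * diag_block (p + n) q B - diag_block 0 p B * X"

lemma diag_block_carrier [simp]: "diag_block s k B \<in> carrier_mat k k"
  by (simp add: diag_block_def)

lemma diag_block_dim [simp]: "dim_row (diag_block s k B) = k" "dim_col (diag_block s k B) = k"
  by (simp_all add: diag_block_def)

lemma m_action_eq:
  "m_action n p q B f X = (if X \<in> carrier_mat p q
    then deriv (\<lambda>t. f (action_curve n p q B X t)) 0 else 0)"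
proof -
  have "transpose_mat (1\<^sub>m p + t \<cdot>\<^sub>m - transpose_mat (diag_block 0 p B)) = 1\<^sub>m p - t \<cdot>\<^sub>m diag_block 0 p B" for t
    by (rule eq_matI) (auto simp: diag_block_def)
  then show ?thesis by (simp add: m_action_def action_curve_def)
qed

lemma action_curve_eq:
  assumes X: "X \<in> carrier_mat p q"
  shows "action_curve n p q B X t = X + t \<cdot>\<^sub>m action_velocity n p q B X
    - (t * t) \<cdot>\<^sub>m (diag_block 0 p B * X * diag_block (p + n) q B)"
proof -
  let ?P = "diag_block 0 p B" and ?Q = "diag_block (p + n) q B"
  have P: "?P \<in> carrier_mat p p" and Q: "?Q \<in> carrier_mat q q" by simp_all
  have PX: "?P * X \<in> carrier_mat p q" using P X by (rule mult_carrier_mat)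
  have XQ: "X * ?Q \<in> carrier_mat p q" using X Q by (rule mult_carrier_mat)
  have PXQ: "?P * X * ?Q \<in> carrier_mat p q" using PX Q by (rule mult_carrier_mat)
  have "(1\<^sub>m p - t \<cdot>\<^sub>m ?P) * X = X - t \<cdot>\<^sub>m (?P * X)"
    using X P by (simp add: minus_mult_distrib_mat[of _ p p] mult_smult_assoc_mat[of _ p p])
  moreover have XPX: "X - t \<cdot>\<^sub>m (?P * X) \<in> carrier_mat p q"
    using PX by (intro minus_carrier_mat smult_carrier_mat)
  ultimately have "action_curve n p q B X t = (X - t \<cdot>\<^sub>m (?P * X)) * (1\<^sub>m q + t \<cdot>\<^sub>m ?Q)"
    by (simp add: action_curve_def)
  also have "\<dots> = (X - t \<cdot>\<^sub>m (?P * X)) + t \<cdot>\<^sub>m ((X - t \<cdot>\<^sub>m (?P * X)) * ?Q)"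
    using XPX Q by (simp add: right_mult_one_mat[OF XPX] mult_add_distrib_mat[of _ p q _ q] mult_smult_distrib[of _ p q _ q])
  also have "(X - t \<cdot>\<^sub>m (?P * X)) * ?Q = X * ?Q - t \<cdot>\<^sub>m (?P * X * ?Q)"
    using X PX Q by (simp add: minus_mult_distrib_mat[of _ p q _ _ q] mult_smult_assoc_mat[of _ p q _ q])
  finally show ?thesis
    unfolding action_velocity_def
    by (simp only:) (rule eq_matI, use X PX XQ PXQ in \<open>auto simp: algebra_simps\<close>)
qed

lemma action_curve_carrier: "X \<in> carrier_mat p q \<Longrightarrow> action_curve n p q B X t \<in> carrier_mat p q"
  unfolding action_curve_def
  by (intro mult_carrier_mat[of _ p q] mult_carrier_mat[of _ p p] minus_carrier_mat add_carrier_mat) auto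

lemma action_curve_zero: "X \<in> carrier_mat p q \<Longrightarrow> action_curve n p q B X 0 = X"
  by (rule eq_matI) (auto simp: action_curve_eq action_velocity_def)

lemma action_curve_entry_deriv:
  assumes X: "X \<in> carrier_mat p q" and ij: "i < p" "j < q"
  shows "((\<lambda>t. action_curve n p q B X t $$ (i, j)) has_field_derivative
    action_velocity n p q B X $$ (i, j)) (at 0)"
proof -
  let ?V = "action_velocity n p q B X" and ?W = "diag_block 0 p B * X * diag_block (p + n) q B"
  have c: "?V \<in> carrier_mat p q" "?W \<in> carrier_mat p q"
    unfolding action_velocity_def using X
    by (intro minus_carrier_mat mult_carrier_mat[of _ p p] mult_carrier_mat[of _ p q] diag_block_carrier; simp)+
  have "action_curve n p q B X t $$ (i, j) = X $$ (i, j) + t * ?V $$ (i, j) - t * t * ?W $$ (i, j)" for t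
    unfolding action_curve_eq[OF X] using c X ij by simp
  then show ?thesis
    by (simp only:) (auto intro!: derivative_eq_intros)
qed

text \<open>Needed for the sum and product rules of \<open>deriv\<close>, which make the action a derivation.\<close>
lemma poly_M_along_curve:
  assumes "f \<in> poly_M p q" and X: "X \<in> carrier_mat p q"
  shows "(\<lambda>t. f (action_curve n p q B X t)) field_differentiable (at 0)"
  using assms(1)
proof (induction rule: poly_M.induct)
  case (coord i j)
  then show ?case
    using action_curve_entry_deriv[OF X coord] action_curve_carrier[OF X]
    by (auto simp: field_differentiable_def)
qed (auto simp: action_curve_carrier[OF X] intro!: derivative_intros)

lemma m_action_coord_entry:
  assumes "i < p" "j < q"
  shows "m_action n p q B (coord p q i j)
    = (\<lambda>X. if X \<in> carrier_mat p q then action_velocity n p q B X $$ (i, j) else 0)"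
  using DERIV_imp_deriv[OF action_curve_entry_deriv[OF _ assms]] action_curve_carrier
  by (auto simp: m_action_eq fun_eq_iff)

text \<open>The same value as a linear combination of coordinates.  It shows that the action preserves
polynomials and lets a second operator be applied.\<close>
lemma m_action_coord:
  assumes "i < p" "j < q"
  shows "m_action n p q B (coord p q i j) =
    (\<Sum>l<q. cscale (B $$ (p + n + l, p + n + j)) (coord p q i l))
      - (\<Sum>k<p. cscale (B $$ (i, k)) (coord p q k j))"
  unfolding m_action_coord_entry[OF assms]
proof
  fix X
  show "(if X \<in> carrier_mat p q then action_velocity n p q B X $$ (i, j) else 0) =
    ((\<Sum>l<q. cscale (B $$ (p + n + l, p + n + j)) (coord p q i l))
      - (\<Sum>k<p. cscale (B $$ (i, k)) (coord p q k j))) X"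
    using assms
    by (auto simp: action_velocity_def sum_fun_apply cscale_def scalar_prod_def diag_block_def
        lessThan_atLeast0 mult.commute)
qed

lemma derivation_m_action: "derivation p q (m_action n p q B)"
proof -
  have zero: "m_action n p q B (poly_const p q c) = 0" for c
    by (auto simp: m_action_eq fun_eq_iff action_curve_carrier)
  have plus: "m_action n p q B (\<lambda>X. f X + g X) = (\<lambda>X. m_action n p q B f X + m_action n p q B g X)"
    if "f \<in> poly_M p q" "g \<in> poly_M p q" for f g
    using that by (auto simp: m_action_eq fun_eq_iff deriv_add poly_M_along_curve)
  have times: "m_action n p q B (\<lambda>X. f X * g X)
      = (\<lambda>X. m_action n p q B f X * g X + f X * m_action n p q B g X)"
    if "f \<in> poly_M p q" "g \<in> poly_M p q" for f g
    using that by (auto simp: m_action_eq fun_eq_iff deriv_mult poly_M_along_curve action_curve_zero)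
  have "m_action n p q B f \<in> poly_M p q" if "f \<in> poly_M p q" for f
    using that
  proof (induction rule: poly_M.induct)
    case (const c)
    show ?case unfolding zero by (rule cfun.subspace_0[OF subspace_poly_M])
  next
    case (coord i j)
    then show ?case unfolding m_action_coord[OF coord]
      by (intro cfun.subspace_diff cfun.subspace_sum cfun.subspace_scale subspace_poly_M poly_M.coord) auto
  next
    case (add f g)
    then show ?case unfolding plus[OF add.hyps] by (intro poly_M.add)
  next
    case (mult f g)
    then show ?case unfolding times[OF mult.hyps] by (intro poly_M.add poly_M.mult)
  qed
  with zero plus times show ?thesis unfolding derivation_def by blast
qed

text \<open>Compression to a diagonal block is not multiplicative in general, but the terms of the product
that pass through another block vanish on the Levi subalgebra.\<close>
lemma diag_block_mult:
  assumes A: "A \<in> alg_m n p q" and B: "B \<in> alg_m n p q"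
  shows "diag_block 0 p (A * B) = diag_block 0 p A * diag_block 0 p B"
    and "diag_block (p + n) q (A * B) = diag_block (p + n) q A * diag_block (p + n) q B"
proof -
  have c: "A \<in> carrier_mat (n + p + q) (n + p + q)" "B \<in> carrier_mat (n + p + q) (n + p + q)"
    using A B by (auto simp: alg_m_iff sl_def)
  have off: "A $$ (i, j) = 0" if "i < n + p + q" "j < n + p + q" "block n p i \<noteq> block n p j" for i j
    using A that by (auto simp: alg_m_iff)
  show "diag_block 0 p (A * B) = diag_block 0 p A * diag_block 0 p B"
  proof (rule eq_matI)
    fix i j assume "i < dim_row (diag_block 0 p A * diag_block 0 p B)"
      "j < dim_col (diag_block 0 p A * diag_block 0 p B)"
    then have ij: "i < p" "j < p" by (auto simp: diag_block_def)
    have "(\<Sum>k = 0..<n + p + q. A $$ (i, k) * B $$ (k, j)) = (\<Sum>k = 0..<p. A $$ (i, k) * B $$ (k, j))"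
      by (rule sum.mono_neutral_right) (use off ij in \<open>auto simp: block_def\<close>)
    then show "diag_block 0 p (A * B) $$ (i, j) = (diag_block 0 p A * diag_block 0 p B) $$ (i, j)"
      using c ij by (simp add: diag_block_def scalar_prod_def)
  qed (auto simp: diag_block_def)
  show "diag_block (p + n) q (A * B) = diag_block (p + n) q A * diag_block (p + n) q B"
  proof (rule eq_matI)
    fix i j assume "i < dim_row (diag_block (p + n) q A * diag_block (p + n) q B)"
      "j < dim_col (diag_block (p + n) q A * diag_block (p + n) q B)"
    then have ij: "i < q" "j < q" by (auto simp: diag_block_def)
    have "(\<Sum>k = 0..<n + p + q. A $$ (p + n + i, k) * B $$ (k, p + n + j))
        = (\<Sum>k = p + n..<n + p + q. A $$ (p + n + i, k) * B $$ (k, p + n + j))"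
      by (rule sum.mono_neutral_right) (use off ij in \<open>auto simp: block_def\<close>)
    also have "\<dots> = (\<Sum>k = 0..<q. A $$ (p + n + i, p + n + k) * B $$ (p + n + k, p + n + j))"
      by (rule sum.reindex_bij_witness[of _ "\<lambda>k. p + n + k" "\<lambda>k. k - (p + n)"]) auto
    finally show "diag_block (p + n) q (A * B) $$ (i, j)
        = (diag_block (p + n) q A * diag_block (p + n) q B) $$ (i, j)"
      using c ij by (simp add: diag_block_def scalar_prod_def)
  qed (auto simp: diag_block_def)
qed

lemma diag_block_diff:
  assumes "A \<in> carrier_mat N N" "B \<in> carrier_mat N N" "s + k \<le> N"
  shows "diag_block s k (A - B) = diag_block s k A - diag_block s k B"
  by (rule eq_matI) (use assms in \<open>auto simp: diag_block_def\<close>)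

text \<open>Both sides are derivations, hence compared on coordinates.  With diagonal blocks \<open>P\<close>, \<open>Q\<close>
of \<open>A\<close> and \<open>R\<close>, \<open>S\<close> of \<open>B\<close>, applying \<open>B\<close> and then \<open>A\<close> to the coordinates gives the entries of
\<open>(X Q - P X) S - R (X Q - P X)\<close>; antisymmetrising leaves
\<open>X (Q S - S Q) - (P R - R P) X\<close>.\<close>
lemma m_action_bracket:
  assumes A: "A \<in> alg_m n p q" and B: "B \<in> alg_m n p q" and f: "f \<in> poly_M p q"
  shows "m_action n p q (bracket A B) f
    = m_action n p q A (m_action n p q B f) - m_action n p q B (m_action n p q A f)"
proof (rule derivation_eqI[OF derivation_m_action
      derivation_commutator[OF derivation_m_action derivation_m_action] _ f])
  fix i j assume ij: "i < p" "j < q"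
  let ?N = "n + p + q"
  have c: "A \<in> carrier_mat ?N ?N" "B \<in> carrier_mat ?N ?N"
    using A B by (auto simp: alg_m_iff sl_def)
  have twice: "m_action n p q C (m_action n p q D (coord p q i j)) X =
      (action_velocity n p q C X * diag_block (p + n) q D
        - diag_block 0 p D * action_velocity n p q C X) $$ (i, j)"
    if X: "X \<in> carrier_mat p q" for C D X
  proof -
    have V: "action_velocity n p q C X \<in> carrier_mat p q"
      unfolding action_velocity_def using X
      by (intro minus_carrier_mat mult_carrier_mat[of _ p p] mult_carrier_mat[of _ p q]) auto
    have s: "(\<Sum>l<q. cscale (D $$ (p + n + l, p + n + j)) (coord p q i l)) \<in> poly_M p q"
      "(\<Sum>k<p. cscale (D $$ (i, k)) (coord p q k j)) \<in> poly_M p q"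
      using ij by (auto intro!: cfun.subspace_sum cfun.subspace_scale subspace_poly_M poly_M.coord)
    have diff: "m_action n p q C (f - g) = m_action n p q C f - m_action n p q C g"
      if "f \<in> poly_M p q" "g \<in> poly_M p q" for f g
      using derivation_add[OF derivation_m_action, of "f - g" p q g n C] that
      by (simp add: cfun.subspace_diff[OF subspace_poly_M])
    have "m_action n p q C (m_action n p q D (coord p q i j)) =
      (\<Sum>l<q. cscale (D $$ (p + n + l, p + n + j)) (m_action n p q C (coord p q i l)))
        - (\<Sum>k<p. cscale (D $$ (i, k)) (m_action n p q C (coord p q k j)))"
      unfolding m_action_coord[OF ij, of n D] diff[OF s] using ij
      by (subst (1 2) derivation_linear_combination[OF derivation_m_action])
        (auto intro: poly_M.coord)
    then show ?thesis
      using X V ij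
      by (simp add: sum_fun_apply cscale_def m_action_coord_entry scalar_prod_def diag_block_def
          lessThan_atLeast0 mult.commute)
  qed
  show "m_action n p q (bracket A B) (coord p q i j)
      = m_action n p q A (m_action n p q B (coord p q i j))
        - m_action n p q B (m_action n p q A (coord p q i j))"
  proof
    fix X :: "complex mat"
    show "m_action n p q (bracket A B) (coord p q i j) X
      = (m_action n p q A (m_action n p q B (coord p q i j))
        - m_action n p q B (m_action n p q A (coord p q i j))) X"
    proof (cases "X \<in> carrier_mat p q")
      case False
      then show ?thesis by (simp add: m_action_eq)
    next
      case X: True
      define P Q R S where "P = diag_block 0 p A" "Q = diag_block (p + n) q A"
        "R = diag_block 0 p B" "S = diag_block (p + n) q B"
      note PQRS = this
      have m: "P \<in> carrier_mat p p" "Q \<in> carrier_mat q q" "R \<in> carrier_mat p p" "S \<in> carrier_mat q q"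
        by (simp_all add: PQRS)
      have AB: "A * B \<in> carrier_mat ?N ?N" "B * A \<in> carrier_mat ?N ?N"
        using c by (auto intro: mult_carrier_mat)
      have "diag_block 0 p (bracket A B) = P * R - R * P"
        unfolding bracket_def PQRS diag_block_mult(1)[OF A B, symmetric] diag_block_mult(1)[OF B A, symmetric]
        by (rule diag_block_diff[OF AB]) simp
      moreover have "diag_block (p + n) q (bracket A B) = Q * S - S * Q"
        unfolding bracket_def PQRS diag_block_mult(2)[OF A B, symmetric] diag_block_mult(2)[OF B A, symmetric]
        by (rule diag_block_diff[OF AB]) simp
      ultimately have "action_velocity n p q (bracket A B) X = X * (Q * S - S * Q) - (P * R - R * P) * X"
        by (simp add: action_velocity_def)
      also have "\<dots> = (X * Q * S - X * S * Q) - (P * R * X - R * P * X)"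
        using m X by (simp add: mult_minus_distrib_mat[of _ p q _ q] minus_mult_distrib_mat[of _ p p]
            assoc_mult_mat[of _ p q _ q _ q])
      finally have lhs: "action_velocity n p q (bracket A B) X
        = (X * Q * S - X * S * Q) - (P * R * X - R * P * X)" .
      have XQ: "X * Q \<in> carrier_mat p q" "X * S \<in> carrier_mat p q"
        "P * X \<in> carrier_mat p q" "R * X \<in> carrier_mat p q"
        using X m by (auto intro: mult_carrier_mat)
      have one: "(X * Q - P * X) * S - R * (X * Q - P * X)
          = (X * Q * S - P * X * S) - (R * X * Q - R * P * X)"
        using m X XQ by (simp add: mult_minus_distrib_mat[of _ p p _ q] minus_mult_distrib_mat[of _ p q _ _ q]
            assoc_mult_mat[of _ p p _ p _ q] assoc_mult_mat[of _ p p _ q _ q])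
      have two: "(X * S - R * X) * Q - P * (X * S - R * X)
          = (X * S * Q - R * X * Q) - (P * X * S - P * R * X)"
        using m X XQ by (simp add: mult_minus_distrib_mat[of _ p p _ q] minus_mult_distrib_mat[of _ p q _ _ q]
            assoc_mult_mat[of _ p p _ p _ q] assoc_mult_mat[of _ p p _ q _ q])
      have cc: "X * Q * S \<in> carrier_mat p q" "X * S * Q \<in> carrier_mat p q"
        "P * R * X \<in> carrier_mat p q" "R * P * X \<in> carrier_mat p q"
        "P * X * S \<in> carrier_mat p q" "R * X * Q \<in> carrier_mat p q"
        using m X XQ by (auto intro: mult_carrier_mat)
      show ?thesis
        unfolding fun_diff_def twice[OF X]
        unfolding m_action_coord_entry[OF ij] lhs
        unfolding action_velocity_def PQRS[symmetric] one two
        using m cc ij X by simp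
    qed
  qed
qed

lemma m_action_add:
  assumes A: "A \<in> carrier_mat (n + p + q) (n + p + q)" and B: "B \<in> carrier_mat (n + p + q) (n + p + q)"
    and f: "f \<in> poly_M p q"
  shows "m_action n p q (A + B) f = m_action n p q A f + m_action n p q B f"
proof (rule derivation_eqI[OF derivation_m_action derivation_sum[OF derivation_m_action derivation_m_action] _ f])
  fix i j assume ij: "i < p" "j < q"
  show "m_action n p q (A + B) (coord p q i j)
      = m_action n p q A (coord p q i j) + m_action n p q B (coord p q i j)"
    unfolding m_action_coord[OF ij] using A B ij
    by (simp add: cfun.scale_left_distrib sum.distrib)
qed

lemma m_action_scale:
  assumes A: "A \<in> carrier_mat (n + p + q) (n + p + q)" and f: "f \<in> poly_M p q"
  shows "m_action n p q (c \<cdot>\<^sub>m A) f = cscale c (m_action n p q A f)"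
proof (rule derivation_eqI[OF derivation_m_action derivation_multiple[OF derivation_m_action] _ f])
  fix i j assume ij: "i < p" "j < q"
  show "m_action n p q (c \<cdot>\<^sub>m A) (coord p q i j) = cscale c (m_action n p q A (coord p q i j))"
    unfolding m_action_coord[OF ij] using A ij
    by (simp add: cfun.scale_right_diff_distrib cfun.scale_sum_right)
qed

lemma lie_module_poly_M: "lie_module (alg_m n p q) (poly_M p q) (m_action n p q)"
proof -
  have c: "A \<in> carrier_mat (n + p + q) (n + p + q)" if "A \<in> alg_m n p q" for A
    using that by (auto simp: alg_m_iff sl_def)
  show ?thesis
    unfolding lie_module_def
    by (intro conjI ballI allI subspace_poly_M derivation_closed[OF derivation_m_action]
        derivation_add[OF derivation_m_action] derivation_scale[OF derivation_m_action]
        m_action_add[OF c c] m_action_scale[OF c] m_action_bracket)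
qed

lemma m_action_cartan_coord:
  assumes H: "H \<in> cartan (n + p + q)" and ij: "i < p" "j < q"
  shows "m_action n p q H (coord p q i j) = cscale (H $$ (p + n + j, p + n + j) - H $$ (i, i)) (coord p q i j)"
proof -
  have off: "H $$ (k, l) = 0" if "k < n + p + q" "l < n + p + q" "k \<noteq> l" for k l
    using H that by (auto simp: cartan_def sl_def diagonal_mat_def)
  have "(\<Sum>l<q. cscale (H $$ (p + n + l, p + n + j)) (coord p q i l))
      = (\<Sum>l<q. if l = j then cscale (H $$ (p + n + j, p + n + j)) (coord p q i j) else 0)"
    by (rule sum.cong) (use off ij in auto)
  moreover have "(\<Sum>k<p. cscale (H $$ (i, k)) (coord p q k j))
      = (\<Sum>k<p. if k = i then cscale (H $$ (i, i)) (coord p q i j) else 0)"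
    by (rule sum.cong) (use off ij in auto)
  ultimately show ?thesis
    unfolding m_action_coord[OF ij] using ij by (simp add: cfun.scale_left_diff_distrib)
qed

section \<open>Characters of modules with a basis of weight vectors\<close>

lemma linear_on_sum:
  assumes L: "cfun.subspace L"
    and add: "\<And>v w. v \<in> L \<Longrightarrow> w \<in> L \<Longrightarrow> T (v + w) = T v + T w"
    and scale: "\<And>c v. v \<in> L \<Longrightarrow> T (cscale c v) = cscale c (T v)"
    and v: "\<And>k. k \<in> F \<Longrightarrow> v k \<in> L"
  shows "T (\<Sum>k\<in>F. v k) = (\<Sum>k\<in>F. T (v k))"
proof -
  have T0: "T 0 = 0"
    using scale[OF cfun.subspace_0[OF L], of 0] by (simp only: cfun.scale_zero_left)
  show ?thesis
    using v
  proof (induction F rule: infinite_finite_induct)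
    case (insert x F)
    have IH: "T (\<Sum>k\<in>F. v k) = (\<Sum>k\<in>F. T (v k))" by (rule insert.IH) (simp add: insert.prems)
    have eq: "T (v x + (\<Sum>k\<in>F. v k)) = T (v x) + T (\<Sum>k\<in>F. v k)"
      by (intro add cfun.subspace_sum L insert.prems) auto
    show ?case by (simp only: sum.insert[OF insert.hyps] eq IH)
  qed (simp_all add: T0)
qed

text \<open>The argument of Dedekind's lemma on characters.  Single out an index \<open>k0\<close>.  An operator that
tells \<open>k\<close> from \<open>k0\<close>, minus its eigenvalue at \<open>k0\<close>, kills the \<open>k0\<close> term of the relation and
multiplies the \<open>k\<close> term by a nonzero scalar, which leaves a shorter relation.  The coefficients of
a linear relation are absorbed in the vectors.\<close>
lemma joint_eigenvectors_independent:
  fixes v :: "'k \<Rightarrow> 'x \<Rightarrow> complex"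
  assumes fin: "finite F" and L: "cfun.subspace L"
    and add: "\<And>s v w. s \<in> S \<Longrightarrow> v \<in> L \<Longrightarrow> w \<in> L \<Longrightarrow> T s (v + w) = T s v + T s w"
    and scale: "\<And>s c v. s \<in> S \<Longrightarrow> v \<in> L \<Longrightarrow> T s (cscale c v) = cscale c (T s v)"
    and mem: "\<And>k. k \<in> F \<Longrightarrow> v k \<in> L"
    and eigen: "\<And>k s. k \<in> F \<Longrightarrow> s \<in> S \<Longrightarrow> T s (v k) = cscale (ev k s) (v k)"
    and separated: "\<And>k l. k \<in> F \<Longrightarrow> l \<in> F \<Longrightarrow> k \<noteq> l \<Longrightarrow> \<exists>s\<in>S. ev k s \<noteq> ev l s"
    and sum: "(\<Sum>k\<in>F. v k) = 0"
  shows "\<forall>k\<in>F. v k = 0"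
  using fin mem eigen separated sum
proof (induction F arbitrary: v)
  case (insert k0 F)
  have F0: "v k = 0" if k: "k \<in> F" for k
  proof -
    have "k \<noteq> k0" using k insert.hyps by blast
    then obtain s where s: "s \<in> S" "ev k s \<noteq> ev k0 s"
      using insert.prems(3)[of k k0] k by blast
    (* ?u is the relation after applying T s - ev k0 s; its k0 term vanishes. *)
    let ?u = "\<lambda>l. cscale (ev l s - ev k0 s) (v l)"
    have "T s (\<Sum>l\<in>insert k0 F. v l) = (\<Sum>l\<in>insert k0 F. T s (v l))"
      by (rule linear_on_sum[OF L add[OF s(1)] scale[OF s(1)] insert.prems(1)])
    also have "\<dots> = (\<Sum>l\<in>insert k0 F. cscale (ev l s) (v l))"
      by (rule sum.cong[OF refl]) (rule insert.prems(2)[OF _ s(1)])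
    finally have "(\<Sum>l\<in>insert k0 F. cscale (ev l s) (v l)) = T s 0"
      by (simp only: insert.prems(4))
    also have "\<dots> = 0"
      using scale[OF s(1) cfun.subspace_0[OF L], of 0] by (simp only: cfun.scale_zero_left)
    finally have "(\<Sum>l\<in>insert k0 F. cscale (ev l s) (v l)) = 0" .
    moreover have "(\<Sum>l\<in>insert k0 F. cscale (ev k0 s) (v l)) = 0"
      by (simp only: cfun.scale_sum_right[symmetric] insert.prems(4) cfun.scale_zero_right)
    ultimately have "(\<Sum>l\<in>insert k0 F. ?u l) = 0"
      by (simp only: cfun.scale_left_diff_distrib sum_subtractf diff_self)
    then have "?u k0 + (\<Sum>l\<in>F. ?u l) = 0"
      by (simp only: sum.insert[OF insert.hyps])
    then have "(\<Sum>l\<in>F. ?u l) = 0"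
      by (simp only: diff_self cfun.scale_zero_left add_0)
    moreover have "T t (?u l) = cscale (ev l t) (?u l)" if "l \<in> F" "t \<in> S" for l t
    proof -
      have "T t (?u l) = cscale (ev l s - ev k0 s) (T t (v l))"
        using that insert.prems(1) by (intro scale) auto
      then show ?thesis using insert.prems(2)[of l t] that
        by (simp only: insert_iff simp_thms cfun.scale_left_commute)
    qed
    ultimately have "\<forall>l\<in>F. ?u l = 0"
      using insert.prems(1,3) by (intro insert.IH) (auto intro: cfun.subspace_scale[OF L])
    then show "v k = 0" using k s(2) cfun.scale_eq_0_iff by (metis right_minus_eq)
  qed
  have "v k0 + (\<Sum>k\<in>F. v k) = 0" using insert.prems(4) by (simp only: sum.insert[OF insert.hyps])
  moreover have "(\<Sum>k\<in>F. v k) = 0" using F0 by (rule sum.neutral[rule_format])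
  ultimately have "v k0 = 0" by (simp only: add_0_right)
  with F0 show ?case by blast
qed simp

text \<open>Once a basis of weight vectors with finite fibres over the weights is known, the weight
decomposition and the character can be read off: weight spaces are spanned by the basis vectors of
that weight.\<close>
locale weight_basis =
  fixes N :: nat and L :: "('x \<Rightarrow> complex) set"
    and \<rho> :: "complex mat \<Rightarrow> ('x \<Rightarrow> complex) \<Rightarrow> 'x \<Rightarrow> complex"
    and I :: "'i set" and e :: "'i \<Rightarrow> 'x \<Rightarrow> complex" and wt :: "'i \<Rightarrow> weight"
  assumes action_add: "H \<in> cartan N \<Longrightarrow> v \<in> L \<Longrightarrow> u \<in> L \<Longrightarrow> \<rho> H (v + u) = \<rho> H v + \<rho> H u"
    and action_scale: "H \<in> cartan N \<Longrightarrow> v \<in> L \<Longrightarrow> \<rho> H (cscale c v) = cscale c (\<rho> H v)"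
    and span_basis: "L = cfun.span (e ` I)"
    and inj_basis: "inj_on e I"
    and independent_basis: "cfun.independent (e ` I)"
    and basis_weight: "i \<in> I \<Longrightarrow> H \<in> cartan N \<Longrightarrow> \<rho> H (e i) = cscale (wt i H) (e i)"
    and weight_dual: "i \<in> I \<Longrightarrow> wt i \<in> dual_cartan N"
    and finite_fibres: "finite {i \<in> I. wt i = \<xi>}"
begin

lemma subspace_L: "cfun.subspace L"
  unfolding span_basis by (rule cfun.subspace_span)

lemma basis_in_weight_space: "i \<in> I \<Longrightarrow> e i \<in> weight_space N L \<rho> (wt i)"
  unfolding weight_space_def using basis_weight by (auto simp: span_basis cfun.span_base)

lemma subspace_weight_space: "cfun.subspace (weight_space N L \<rho> \<xi>)"
proof (rule cfun.subspaceI)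
  have "\<rho> H 0 = 0" if "H \<in> cartan N" for H
    using action_scale[OF that cfun.subspace_0[OF subspace_L], of 0] by (simp only: cfun.scale_zero_left)
  then show "0 \<in> weight_space N L \<rho> \<xi>"
    unfolding weight_space_def mem_Collect_eq cfun.scale_zero_right
    using cfun.subspace_0[OF subspace_L] by blast
next
  fix v u assume "v \<in> weight_space N L \<rho> \<xi>" "u \<in> weight_space N L \<rho> \<xi>"
  then show "v + u \<in> weight_space N L \<rho> \<xi>"
    unfolding weight_space_def using action_add cfun.subspace_add[OF subspace_L]
    by (simp only: mem_Collect_eq cfun.scale_right_distrib) metis
next
  fix c v assume "v \<in> weight_space N L \<rho> \<xi>"
  then show "cscale c v \<in> weight_space N L \<rho> \<xi>"
    unfolding weight_space_def using action_scale cfun.subspace_scale[OF subspace_L]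
    by (simp only: mem_Collect_eq) (metis cfun.scale_left_commute)
qed

text \<open>Distinct elements of the dual differ on the Cartan subalgebra, because their extensions to all
matrices vanish outside it.\<close>
lemma weight_vectors_independent:
  assumes "finite F" "F \<subseteq> dual_cartan N" "\<And>\<xi>. \<xi> \<in> F \<Longrightarrow> c \<xi> \<in> weight_space N L \<rho> \<xi>"
    and "(\<Sum>\<xi>\<in>F. c \<xi>) = 0" "\<xi> \<in> F"
  shows "c \<xi> = 0"
proof -
  have "\<forall>\<xi>\<in>F. c \<xi> = 0"
  proof (rule joint_eigenvectors_independent[OF assms(1) subspace_L,
        where S = "cartan N" and T = \<rho> and ev = "\<lambda>\<xi>. \<xi>"])
    fix \<xi> \<eta> assume "\<xi> \<in> F" "\<eta> \<in> F" "\<xi> \<noteq> \<eta>"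
    then obtain H where "\<xi> H \<noteq> \<eta> H" by blast
    moreover have "\<xi> H = 0 \<and> \<eta> H = 0" if "H \<notin> cartan N"
      using that \<open>\<xi> \<in> F\<close> \<open>\<eta> \<in> F\<close> assms(2) by (auto simp: dual_cartan_def)
    ultimately show "\<exists>H\<in>cartan N. \<xi> H \<noteq> \<eta> H" by metis
  qed (use assms action_add action_scale in \<open>auto simp: weight_space_def\<close>)
  with assms(5) show ?thesis by blast
qed

text \<open>Expand in the basis and collect the terms of equal weight.  The components are shown to lie in the
span of the basis vectors of that weight, which is more than being weight vectors and identifies
the weight spaces afterwards.\<close>
lemma decomposition_exists:
  assumes "v \<in> L"
  shows "\<exists>c. (\<forall>\<xi>. c \<xi> \<in> cfun.span (e ` {i \<in> I. wt i = \<xi>})) \<and> finite {\<xi>. c \<xi> \<noteq> 0} \<and>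
    {\<xi>. c \<xi> \<noteq> 0} \<subseteq> dual_cartan N \<and> v = (\<Sum>\<xi> | c \<xi> \<noteq> 0. c \<xi>)"
proof -
  obtain t r where t: "finite t" "t \<subseteq> e ` I" and v: "v = (\<Sum>a\<in>t. cscale (r a) a)"
    using assms unfolding span_basis cfun.span_explicit by blast
  obtain F where F: "F \<subseteq> I" "inj_on e F" "t = e ` F"
    using t(2) by (auto simp: subset_image_inj)
  have finF: "finite F" using t(1) F by (simp add: finite_image_iff)
  define c where "c \<xi> = (\<Sum>i\<in>{i \<in> F. wt i = \<xi>}. cscale (r (e i)) (e i))" for \<xi>
  have supp: "{\<xi>. c \<xi> \<noteq> 0} \<subseteq> wt ` F"
  proof
    fix \<xi> assume "\<xi> \<in> {\<xi>. c \<xi> \<noteq> 0}"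
    then have "c \<xi> \<noteq> 0" by simp
    then obtain i where "i \<in> {i \<in> F. wt i = \<xi>}"
      unfolding c_def by (meson sum.not_neutral_contains_not_neutral)
    then show "\<xi> \<in> wt ` F" by auto
  qed
  show ?thesis
  proof (intro exI[of _ c] conjI allI)
    show "c \<xi> \<in> cfun.span (e ` {i \<in> I. wt i = \<xi>})" for \<xi>
      unfolding c_def using F(1) by (intro cfun.span_sum cfun.span_scale cfun.span_base) auto
    show "finite {\<xi>. c \<xi> \<noteq> 0}" using supp finF by (rule finite_subset[OF _ finite_imageI])
    show "{\<xi>. c \<xi> \<noteq> 0} \<subseteq> dual_cartan N" using supp F(1) weight_dual by blast
    have "v = (\<Sum>i\<in>F. cscale (r (e i)) (e i))"
      unfolding v F(3) by (simp only: sum.reindex[OF F(2)] o_def)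
    also have "\<dots> = (\<Sum>\<xi>\<in>wt ` F. c \<xi>)"
      unfolding c_def by (rule sum.image_gen[OF finF])
    also have "\<dots> = (\<Sum>\<xi> | c \<xi> \<noteq> 0. c \<xi>)"
      using finF supp by (intro sum.mono_neutral_right) auto
    finally show "v = (\<Sum>\<xi> | c \<xi> \<noteq> 0. c \<xi>)" .
  qed
qed

lemma span_fibre_subset:
  "cfun.span (e ` {i \<in> I. wt i = \<xi>}) \<subseteq> weight_space N L \<rho> \<xi>"
  by (rule cfun.span_minimal[OF _ subspace_weight_space]) (use basis_in_weight_space in auto)

lemma decomposition_unique:
  assumes c: "\<And>\<xi>. \<xi> \<in> dual_cartan N \<Longrightarrow> c \<xi> \<in> weight_space N L \<rho> \<xi>"
    "finite {\<xi>. c \<xi> \<noteq> 0}" "{\<xi>. c \<xi> \<noteq> 0} \<subseteq> dual_cartan N"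
    and d: "\<And>\<xi>. \<xi> \<in> dual_cartan N \<Longrightarrow> d \<xi> \<in> weight_space N L \<rho> \<xi>"
    "finite {\<xi>. d \<xi> \<noteq> 0}" "{\<xi>. d \<xi> \<noteq> 0} \<subseteq> dual_cartan N"
    and eq: "(\<Sum>\<xi> | c \<xi> \<noteq> 0. c \<xi>) = (\<Sum>\<xi> | d \<xi> \<noteq> 0. d \<xi>)"
  shows "c = d"
proof
  fix \<xi>
  let ?F = "{\<xi>. c \<xi> \<noteq> 0} \<union> {\<xi>. d \<xi> \<noteq> 0}"
  have fin: "finite ?F" using c(2) d(2) by blast
  have "(\<Sum>\<xi>\<in>?F. c \<xi>) = (\<Sum>\<xi> | c \<xi> \<noteq> 0. c \<xi>)"
    by (rule sum.mono_neutral_right[OF fin]) auto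
  moreover have "(\<Sum>\<xi>\<in>?F. d \<xi>) = (\<Sum>\<xi> | d \<xi> \<noteq> 0. d \<xi>)"
    by (rule sum.mono_neutral_right[OF fin]) auto
  ultimately have sum0: "(\<Sum>\<xi>\<in>?F. c \<xi> - d \<xi>) = 0"
    by (simp only: sum_subtractf eq diff_self)
  show "c \<xi> = d \<xi>"
  proof (cases "\<xi> \<in> ?F")
    case True
    have "c \<xi> - d \<xi> = 0"
    proof (rule weight_vectors_independent[of ?F "\<lambda>\<xi>. c \<xi> - d \<xi>", OF fin _ _ sum0 True])
      show "?F \<subseteq> dual_cartan N" using c(3) d(3) by blast
      then show "c \<xi> - d \<xi> \<in> weight_space N L \<rho> \<xi>" if "\<xi> \<in> ?F" for \<xi>
        using that by (intro cfun.subspace_diff[OF subspace_weight_space] c(1) d(1)) blast+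
    qed
    then show ?thesis by (simp only: right_minus_eq)
  qed simp
qed

text \<open>A weight vector is its own decomposition, so by uniqueness it equals its component collected from
the basis.\<close>
lemma weight_space_eq_span:
  assumes "\<xi> \<in> dual_cartan N"
  shows "weight_space N L \<rho> \<xi> = cfun.span (e ` {i \<in> I. wt i = \<xi>})"
proof (intro equalityI span_fibre_subset subsetI)
  fix v assume v: "v \<in> weight_space N L \<rho> \<xi>"
  then have "v \<in> L" by (simp add: weight_space_def)
  then obtain c where c: "\<And>\<xi>. c \<xi> \<in> cfun.span (e ` {i \<in> I. wt i = \<xi>})"
    "finite {\<xi>. c \<xi> \<noteq> 0}" "{\<xi>. c \<xi> \<noteq> 0} \<subseteq> dual_cartan N" "v = (\<Sum>\<xi> | c \<xi> \<noteq> 0. c \<xi>)"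
    using decomposition_exists by blast
  define d where "d \<eta> = (if \<eta> = \<xi> then v else 0)" for \<eta>
  have supp: "{\<eta>. d \<eta> \<noteq> 0} \<subseteq> {\<xi>}" by (auto simp: d_def)
  have "(\<Sum>\<eta> | d \<eta> \<noteq> 0. d \<eta>) = (\<Sum>\<eta>\<in>{\<xi>}. d \<eta>)"
    by (rule sum.mono_neutral_left) (use supp in auto)
  then have sum_d: "(\<Sum>\<eta> | c \<eta> \<noteq> 0. c \<eta>) = (\<Sum>\<eta> | d \<eta> \<noteq> 0. d \<eta>)"
    using c(4) by (simp add: d_def)
  have "c = d"
  proof (rule decomposition_unique[OF _ c(2,3) _ _ _ sum_d])
    show "c \<eta> \<in> weight_space N L \<rho> \<eta>" for \<eta> using c(1) span_fibre_subset by blast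
    show "d \<eta> \<in> weight_space N L \<rho> \<eta>" for \<eta>
      unfolding d_def using v cfun.subspace_0[OF subspace_weight_space]
      by (cases "\<eta> = \<xi>") (simp_all only: if_True if_False simp_thms)
    show "finite {\<eta>. d \<eta> \<noteq> 0}" using supp by (rule finite_subset) simp
    show "{\<eta>. d \<eta> \<noteq> 0} \<subseteq> dual_cartan N" using supp assms by blast
  qed
  then show "v \<in> cfun.span (e ` {i \<in> I. wt i = \<xi>})" using c(1)[of \<xi>] by (simp add: d_def)
qed

lemma weight_decomposition: "has_weight_decomposition N L \<rho>"
  unfolding has_weight_decomposition_def
proof (intro conjI ballI)
  fix \<xi> assume "\<xi> \<in> dual_cartan N"
  then show "\<exists>B. finite B \<and> weight_space N L \<rho> \<xi> \<subseteq> cfun.span B"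
    using weight_space_eq_span finite_fibres by (intro exI[of _ "e ` {i \<in> I. wt i = \<xi>}"]) auto
next
  fix v assume "v \<in> L"
  then obtain c where c: "\<And>\<xi>. c \<xi> \<in> cfun.span (e ` {i \<in> I. wt i = \<xi>})"
    "finite {\<xi>. c \<xi> \<noteq> 0}" "{\<xi>. c \<xi> \<noteq> 0} \<subseteq> dual_cartan N" "v = (\<Sum>\<xi> | c \<xi> \<noteq> 0. c \<xi>)"
    using decomposition_exists by blast
  show "\<exists>!c. (\<forall>\<xi>\<in>dual_cartan N. c \<xi> \<in> weight_space N L \<rho> \<xi>) \<and>
    (\<forall>\<xi>. \<xi> \<notin> dual_cartan N \<longrightarrow> c \<xi> = 0) \<and> finite {\<xi>. c \<xi> \<noteq> 0} \<and> v = (\<Sum>\<xi> | c \<xi> \<noteq> 0. c \<xi>)"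
  proof (rule ex1I[of _ c], intro conjI ballI allI impI)
    show cw: "c \<xi> \<in> weight_space N L \<rho> \<xi>" for \<xi> using c(1) span_fibre_subset by blast
    show "c \<xi> = 0" if "\<xi> \<notin> dual_cartan N" for \<xi> using that c(3) by blast
    fix d assume d: "(\<forall>\<xi>\<in>dual_cartan N. d \<xi> \<in> weight_space N L \<rho> \<xi>) \<and>
      (\<forall>\<xi>. \<xi> \<notin> dual_cartan N \<longrightarrow> d \<xi> = 0) \<and> finite {\<xi>. d \<xi> \<noteq> 0} \<and> v = (\<Sum>\<xi> | d \<xi> \<noteq> 0. d \<xi>)"
    show "d = c"
      by (rule decomposition_unique) (use d c cw in blast)+
  qed (use c in blast)+
qed

lemma character: "ch N L \<rho> \<xi> = int (card {i \<in> I. wt i = \<xi>})"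
proof (cases "\<xi> \<in> dual_cartan N")
  case True
  have "cfun.independent (e ` {i \<in> I. wt i = \<xi>})"
    by (rule cfun.independent_mono[OF independent_basis]) auto
  then have "cfun.dim (weight_space N L \<rho> \<xi>) = card (e ` {i \<in> I. wt i = \<xi>})"
    unfolding weight_space_eq_span[OF True] by (rule cfun.dim_span_eq_card_independent)
  also have "\<dots> = card {i \<in> I. wt i = \<xi>}"
    by (rule card_image) (rule inj_on_subset[OF inj_basis], auto)
  finally show ?thesis using True by (simp add: ch_def)
next
  case False
  then have "{i \<in> I. wt i = \<xi>} = {}" using weight_dual by blast
  then show ?thesis using False by (simp only: ch_def if_False card.empty of_nat_0)
qed

end

section \<open>The monomial basis and its weights\<close>

text \<open>Multisets of index pairs serve as exponents: addition of multisets is multiplication of monomials,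
and the weight of a monomial is a sum over its multiset.\<close>
definition monomial :: "nat \<Rightarrow> nat \<Rightarrow> (nat \<times> nat) multiset \<Rightarrow> complex mat \<Rightarrow> complex" where
  "monomial p q M X = (if X \<in> carrier_mat p q then \<Prod>k\<in>#M. X $$ k else 0)"

lemma monomial_empty: "monomial p q {#} = poly_const p q 1"
  by (simp add: monomial_def fun_eq_iff)

lemma monomial_add_mset:
  "monomial p q (add_mset (i, j) M) = (\<lambda>X. coord p q i j X * monomial p q M X)"
  by (simp add: monomial_def fun_eq_iff)

lemma monomial_in_poly_M: "set_mset M \<subseteq> {..<p} \<times> {..<q} \<Longrightarrow> monomial p q M \<in> poly_M p q"
proof (induction M)
  case empty
  show ?case unfolding monomial_empty by (rule poly_M.const)
next
  case (add k M)
  obtain i j where k: "k = (i, j)" by (cases k)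
  show ?case
    unfolding k monomial_add_mset using add k by (intro poly_M.mult poly_M.coord) auto
qed

lemma monomial_mult: "(\<lambda>X. monomial p q M X * monomial p q M' X) = monomial p q (M + M')"
  by (auto simp: monomial_def fun_eq_iff)

lemma poly_M_eq_span:
  "poly_M p q = cfun.span (monomial p q ` {M. set_mset M \<subseteq> {..<p} \<times> {..<q}})"
proof
  let ?S = "monomial p q ` {M. set_mset M \<subseteq> {..<p} \<times> {..<q}}"
  show "cfun.span ?S \<subseteq> poly_M p q"
    by (rule cfun.span_minimal[OF _ subspace_poly_M]) (use monomial_in_poly_M in auto)
  have closed: "(\<lambda>X. f X * g X) \<in> cfun.span ?S"
    if f: "f \<in> cfun.span ?S" and g: "\<And>h. h \<in> ?S \<Longrightarrow> (\<lambda>X. h X * g X) \<in> cfun.span ?S" for f g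
    using f
  proof (induction rule: cfun.span_induct_alt)
    case base
    have "(\<lambda>X. 0 X * g X) = 0" by (simp add: fun_eq_iff)
    then show ?case using cfun.span_zero by metis
  next
    case (step c h f)
    have eq: "(\<lambda>X. (cscale c h + f) X * g X) = cscale c (\<lambda>X. h X * g X) + (\<lambda>X. f X * g X)"
      by (simp add: fun_eq_iff cscale_def algebra_simps)
    show ?case unfolding eq by (intro cfun.span_add cfun.span_scale g[OF step(1)] step(2))
  qed
  have mono_mult: "(\<lambda>X. h X * h' X) \<in> cfun.span ?S" if "h \<in> ?S" "h' \<in> ?S" for h h'
  proof -
    from that obtain M M' where "h = monomial p q M" "h' = monomial p q M'"
      "set_mset M \<subseteq> {..<p} \<times> {..<q}" "set_mset M' \<subseteq> {..<p} \<times> {..<q}" by blast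
    then show ?thesis
      unfolding \<open>h = _\<close> \<open>h' = _\<close> monomial_mult
      by (intro cfun.span_base image_eqI[of _ _ "M + M'"]) auto
  qed
  show "poly_M p q \<subseteq> cfun.span ?S"
  proof
    fix f assume "f \<in> poly_M p q"
    then show "f \<in> cfun.span ?S"
    proof (induction rule: poly_M.induct)
      case (const c)
      have "poly_const p q c = cscale c (monomial p q {#})"
        unfolding monomial_empty by (auto simp: cscale_def fun_eq_iff)
      moreover have "monomial p q {#} \<in> ?S" by (rule imageI) simp
      ultimately show ?case by (simp only: cfun.span_base cfun.span_scale)
    next
      case (coord i j)
      have "coord p q i j = monomial p q {#(i, j)#}"
        by (auto simp: monomial_def fun_eq_iff)
      then show ?case using coord by (auto intro!: cfun.span_base)
    next
      case (add f g)
      then show ?case using cfun.span_add[OF add.IH] by (simp add: plus_fun_def)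
    next
      case (mult f g)
      show ?case
      proof (rule closed[OF mult.IH(1)])
        fix h assume h: "h \<in> ?S"
        have "(\<lambda>X. g X * h X) \<in> cfun.span ?S"
          by (rule closed[OF mult.IH(2)]) (rule mono_mult[OF _ h])
        then show "(\<lambda>X. h X * g X) \<in> cfun.span ?S" by (simp only: mult.commute)
      qed
    qed
  qed
qed

text \<open>Doubling one entry of \<open>X\<close> has the monomials as eigenvectors and reads off the exponent of that
entry, since powers of \<open>2\<close> are distinct.\<close>
definition rescale :: "nat \<times> nat \<Rightarrow> complex mat \<Rightarrow> complex mat" where
  "rescale k X = mat (dim_row X) (dim_col X) (\<lambda>l. if l = k then 2 * X $$ l else X $$ l)"

lemma monomial_rescale:
  assumes "set_mset M \<subseteq> {..<p} \<times> {..<q}"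
  shows "monomial p q M (rescale k X) = 2 ^ count M k * monomial p q M X"
proof (cases "X \<in> carrier_mat p q")
  case True
  from assms have "(\<Prod>l\<in>#M. rescale k X $$ l) = 2 ^ count M k * (\<Prod>l\<in>#M. X $$ l)"
  proof (induction M)
    case (add l M)
    then have "rescale k X $$ l = (if l = k then 2 * X $$ l else X $$ l)"
      using True by (auto simp: rescale_def)
    then show ?case using add by auto
  qed simp
  moreover have "rescale k X \<in> carrier_mat p q" using True by (auto simp: rescale_def)
  ultimately show ?thesis using True by (simp add: monomial_def)
next
  case False
  then have "rescale k X \<notin> carrier_mat p q" unfolding carrier_mat_def by (simp add: rescale_def)
  with False show ?thesis by (simp add: monomial_def)
qed

lemma monomial_at_ones: "set_mset M \<subseteq> {..<p} \<times> {..<q} \<Longrightarrow> monomial p q M (mat p q (\<lambda>_. 1)) = 1"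
proof -
  assume "set_mset M \<subseteq> {..<p} \<times> {..<q}"
  then have "(\<Prod>k\<in>#M. mat p q (\<lambda>_. 1 :: complex) $$ k) = 1"
    by (induction M) auto
  then show ?thesis by (simp add: monomial_def)
qed

lemma monomials_independent:
  fixes F :: "(nat \<times> nat) multiset set"
  assumes F: "finite F" "F \<subseteq> {M. set_mset M \<subseteq> {..<p} \<times> {..<q}}"
    and sum: "(\<Sum>M\<in>F. cscale (a M) (monomial p q M)) = 0" and M: "M \<in> F"
  shows "a M = 0"
proof -
  have "\<forall>M\<in>F. cscale (a M) (monomial p q M) = 0"
  proof (rule joint_eigenvectors_independent[OF F(1) cfun.subspace_UNIV _ _ _ _ _ sum,
        where S = UNIV and T = "\<lambda>k f X. f (rescale k X)" and ev = "\<lambda>M k. 2 ^ count M k"])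
    fix M k assume "M \<in> F"
    then show "(\<lambda>X. cscale (a M) (monomial p q M) (rescale k X))
        = cscale (2 ^ count M k) (cscale (a M) (monomial p q M))"
      using F(2) monomial_rescale[of M p q k] by (auto simp: cscale_def fun_eq_iff)
  next
    fix M M' :: "(nat \<times> nat) multiset" assume "M \<noteq> M'"
    then obtain k where "count M k \<noteq> count M' k" by (auto simp: multiset_eq_iff)
    then have "of_nat (2 ^ count M k) \<noteq> (of_nat (2 ^ count M' k) :: complex)"
      by (simp only: of_nat_eq_iff power_inject_exp one_less_numeral_iff semiring_norm not_False_eq_True)
    then show "\<exists>k\<in>UNIV. (2 :: complex) ^ count M k \<noteq> 2 ^ count M' k"
      unfolding of_nat_power of_nat_numeral by blast
  qed (auto simp: cscale_def fun_eq_iff)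
  then have "cscale (a M) (monomial p q M) (mat p q (\<lambda>_. 1)) = 0"
    using M by (metis zero_fun_apply)
  moreover have "monomial p q M (mat p q (\<lambda>_. 1)) = 1"
    using F(2) M by (intro monomial_at_ones) auto
  ultimately show ?thesis by (simp add: cscale_def)
qed

text \<open>Distinct exponents with equal monomials would satisfy the relation with coefficients \<open>1\<close> and
\<open>-1\<close>.\<close>
lemma inj_on_monomial: "inj_on (monomial p q) {M. set_mset M \<subseteq> {..<p} \<times> {..<q}}"
proof (rule inj_onI)
  fix M M' assume M: "M \<in> {M. set_mset M \<subseteq> {..<p} \<times> {..<q}}" "M' \<in> {M. set_mset M \<subseteq> {..<p} \<times> {..<q}}"
    and eq: "monomial p q M = monomial p q M'"
  show "M = M'"
  proof (rule ccontr)
    assume ne: "M \<noteq> M'"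
    let ?a = "\<lambda>K. if K = M then 1 else - 1 :: complex"
    have "(\<Sum>K\<in>{M, M'}. cscale (?a K) (monomial p q K)) = 0"
      using ne eq by (auto simp: cscale_def fun_eq_iff)
    then have "?a M = 0"
      by (rule monomials_independent[rotated 2]) (use M in auto)
    then show False by simp
  qed
qed

lemma independent_monomials:
  "cfun.independent (monomial p q ` {M. set_mset M \<subseteq> {..<p} \<times> {..<q}})"
  unfolding cfun.independent_explicit_finite_subsets
proof (intro allI impI ballI)
  fix S u v
  assume S: "S \<subseteq> monomial p q ` {M. set_mset M \<subseteq> {..<p} \<times> {..<q}}" "finite S"
    and sum: "(\<Sum>v\<in>S. cscale (u v) v) = 0" and v: "v \<in> S"
  obtain F where F: "F \<subseteq> {M. set_mset M \<subseteq> {..<p} \<times> {..<q}}" "inj_on (monomial p q) F" "S = monomial p q ` F"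
    using S(1) by (auto simp: subset_image_inj)
  have "(\<Sum>M\<in>F. cscale (u (monomial p q M)) (monomial p q M)) = 0"
    using sum unfolding F(3) by (simp only: sum.reindex[OF F(2)] o_def)
  moreover have "finite F" using S(2) F by (simp add: finite_image_iff)
  ultimately have "\<forall>M\<in>F. u (monomial p q M) = 0"
    using monomials_independent[OF _ F(1), of "\<lambda>M. u (monomial p q M)"] by blast
  then show "u v = 0" using v F(3) by auto
qed

definition coord_weight :: "nat \<Rightarrow> nat \<Rightarrow> nat \<Rightarrow> nat \<times> nat \<Rightarrow> weight" where
  "coord_weight n p q k = - (eps (n + p + q) (fst k) - eps (n + p + q) (p + n + snd k))"

lemma cartan_add: "H \<in> cartan N \<Longrightarrow> K \<in> cartan N \<Longrightarrow> H + K \<in> cartan N"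
  by (auto simp: cartan_def sl_def tr_def diagonal_mat_def sum.distrib)

lemma cartan_smult: "H \<in> cartan N \<Longrightarrow> c \<cdot>\<^sub>m H \<in> cartan N"
  by (auto simp: cartan_def sl_def tr_def diagonal_mat_def sum_distrib_left[symmetric])

lemma dual_cartan_add: "\<xi> \<in> dual_cartan N \<Longrightarrow> \<eta> \<in> dual_cartan N \<Longrightarrow> \<xi> + \<eta> \<in> dual_cartan N"
  by (simp add: dual_cartan_def algebra_simps)

lemma coord_weight_dual:
  assumes "i < p" "j < q"
  shows "coord_weight n p q (i, j) \<in> dual_cartan (n + p + q)"
  unfolding dual_cartan_def
proof (intro CollectI conjI allI ballI impI)
  let ?N = "n + p + q"
  show "coord_weight n p q (i, j) H = 0" if "H \<notin> cartan ?N" for H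
    using that by (simp add: coord_weight_def eps_def)
  fix H assume H: "H \<in> cartan ?N"
  note dims = cartan_carrier[OF H]
  show "coord_weight n p q (i, j) (H + K) = coord_weight n p q (i, j) H + coord_weight n p q (i, j) K"
    if K: "K \<in> cartan ?N" for K
    using dims cartan_carrier[OF K] assms
    by (simp add: coord_weight_def eps_cartan cartan_add H K)
  show "coord_weight n p q (i, j) (c \<cdot>\<^sub>m H) = c * coord_weight n p q (i, j) H" for c
    using dims assms by (simp add: coord_weight_def eps_cartan cartan_smult H right_diff_distrib)
qed

lemma monomial_weight_dual:
  "set_mset M \<subseteq> {..<p} \<times> {..<q} \<Longrightarrow> (\<Sum>k\<in>#M. coord_weight n p q k) \<in> dual_cartan (n + p + q)"
proof (induction M)
  case empty
  show ?case by (simp add: dual_cartan_def)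
next
  case (add k M)
  then have "coord_weight n p q k \<in> dual_cartan (n + p + q)"
    using coord_weight_dual by (cases k) auto
  moreover have "(\<Sum>k\<in>#M. coord_weight n p q k) \<in> dual_cartan (n + p + q)"
    by (rule add.IH) (use add.prems in simp)
  ultimately show ?case
    by (simp only: image_mset_add_mset sum_mset.add_mset dual_cartan_add)
qed

text \<open>Leibniz rule: weights add when polynomials are multiplied.\<close>
lemma m_action_monomial:
  assumes H: "H \<in> cartan (n + p + q)"
  shows "set_mset M \<subseteq> {..<p} \<times> {..<q} \<Longrightarrow>
    m_action n p q H (monomial p q M) = cscale ((\<Sum>k\<in>#M. coord_weight n p q k) H) (monomial p q M)"
proof (induction M)
  case empty
  show ?case unfolding monomial_empty by (simp add: derivation_const[OF derivation_m_action] cscale_def fun_eq_iff)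
next
  case (add k M)
  obtain i j where k: "k = (i, j)" by (cases k)
  with add.prems have ij: "i < p" "j < q" and M: "set_mset M \<subseteq> {..<p} \<times> {..<q}" by auto
  have wt: "coord_weight n p q (i, j) H = H $$ (p + n + j, p + n + j) - H $$ (i, i)"
    by (simp add: coord_weight_def eps_cartan[OF H])
  have "m_action n p q H (monomial p q (add_mset k M))
      = (\<lambda>X. m_action n p q H (coord p q i j) X * monomial p q M X
          + coord p q i j X * m_action n p q H (monomial p q M) X)"
    unfolding k monomial_add_mset
    by (rule derivation_mult[OF derivation_m_action poly_M.coord[OF ij] monomial_in_poly_M[OF M]])
  also have "\<dots> = cscale ((\<Sum>k\<in>#add_mset k M. coord_weight n p q k) H) (monomial p q (add_mset k M))"
    unfolding m_action_cartan_coord[OF H ij] add.IH[OF M] k monomial_add_mset wt[symmetric]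
    by (simp add: cscale_def fun_eq_iff algebra_simps)
  finally show ?case .
qed

lemma neg_coord_weight_roots:
  assumes "k \<in> {..<p} \<times> {..<q}"
  shows "coord_weight n p q k \<in> uminus ` pos_roots (n + p + q)"
proof -
  have "eps (n + p + q) (fst k) - eps (n + p + q) (p + n + snd k) \<in> pos_roots (n + p + q)"
    unfolding pos_roots_def using assms by (intro CollectI exI conjI) auto
  then show ?thesis unfolding coord_weight_def by (rule imageI)
qed

lemma weight_basis_monomials:
  "weight_basis (n + p + q) (poly_M p q) (m_action n p q) {M. set_mset M \<subseteq> {..<p} \<times> {..<q}}
    (monomial p q) (\<lambda>M. \<Sum>k\<in>#M. coord_weight n p q k)"
proof
  interpret graded_cone "uminus ` pos_roots (n + p + q)" "height (n + p + q)"
    by (rule graded_cone_neg_roots)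
  fix \<xi>
  have "finite {M. set_mset M \<subseteq> {..<p} \<times> {..<q} \<and> (\<Sum>k\<in>#M. coord_weight n p q k) = \<xi>}"
    by (rule finite_partitions) (use neg_coord_weight_roots in auto)
  then show "finite {M \<in> {M. set_mset M \<subseteq> {..<p} \<times> {..<q}}. (\<Sum>k\<in>#M. coord_weight n p q k) = \<xi>}"
    by simp
qed (use derivation_add[OF derivation_m_action] derivation_scale[OF derivation_m_action]
    poly_M_eq_span inj_on_monomial independent_monomials m_action_monomial monomial_weight_dual
    in \<open>simp_all only: mem_Collect_eq not_False_eq_True\<close>)

lemma ch_poly_M:
  "ch (n + p + q) (poly_M p q) (m_action n p q) = partition_count (coord_weight n p q) ({..<p} \<times> {..<q})"
proof -
  interpret weight_basis "n + p + q" "poly_M p q" "m_action n p q" "{M. set_mset M \<subseteq> {..<p} \<times> {..<q}}"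
    "monomial p q" "\<lambda>M. \<Sum>k\<in>#M. coord_weight n p q k" by (rule weight_basis_monomials)
  show ?thesis by (rule ext) (simp only: character partition_count_def mem_Collect_eq)
qed

lemma inj_on_coord_weight: "inj_on (coord_weight n p q) ({..<p} \<times> {..<q})"
proof (rule inj_onI)
  fix k l assume kl: "k \<in> {..<p} \<times> {..<q}" "l \<in> {..<p} \<times> {..<q}"
    and "coord_weight n p q k = coord_weight n p q l"
  then have "eps (n + p + q) (fst k) - eps (n + p + q) (p + n + snd k)
      = eps (n + p + q) (fst l) - eps (n + p + q) (p + n + snd l)"
    unfolding coord_weight_def by (simp only: neg_equal_iff_equal)
  then have "fst k = fst l \<and> p + n + snd k = p + n + snd l"
    using kl by (subst (asm) root_eq_iff) auto
  then show "k = l" by (auto intro: prod_eqI)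
qed

text \<open>The product over the set of roots may be indexed by pairs because distinct pairs give distinct
roots.\<close>
lemma Delta_bar_eq:
  "Delta_bar n p q = finprod (series_ring (n + p + q))
    (\<lambda>k. \<one>\<^bsub>series_ring (n + p + q)\<^esub> \<ominus>\<^bsub>series_ring (n + p + q)\<^esub> fexp (coord_weight n p q k))
    ({..<p} \<times> {..<q})"
proof -
  let ?K = "{..<p} \<times> {..<q}" and ?R = "series_ring (n + p + q)"
  interpret graded_cone "uminus ` pos_roots (n + p + q)" "height (n + p + q)"
    by (rule graded_cone_neg_roots)
  interpret R: cring ?R unfolding series_ring_eq by (rule cring_series)
  have Phi: "Phi_bar n p q = (\<lambda>k. - coord_weight n p q k) ` ?K"
    unfolding Phi_bar_eq coord_weight_def minus_minus by force
  have exp: "fexp \<xi> = exp_series \<xi>" for \<xi> by (simp add: fexp_def exp_series_def)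
  have closed: "\<one>\<^bsub>?R\<^esub> \<ominus>\<^bsub>?R\<^esub> fexp (coord_weight n p q k) \<in> carrier ?R" if "k \<in> ?K" for k
    unfolding series_ring_eq exp
    by (rule factor_closed) (use neg_coord_weight_roots[OF that] in \<open>rule gens_in_cone\<close>)
  have inj: "inj_on (\<lambda>k. - coord_weight n p q k) ?K"
    using inj_on_coord_weight unfolding inj_on_def neg_equal_iff_equal .
  have "Delta_bar n p q = finprod ?R (\<lambda>\<alpha>. \<one>\<^bsub>?R\<^esub> \<ominus>\<^bsub>?R\<^esub> fexp (- \<alpha>)) ((\<lambda>k. - coord_weight n p q k) ` ?K)"
    unfolding Delta_bar_def Phi Let_def ..
  also have "\<dots> = finprod ?R (\<lambda>k. \<one>\<^bsub>?R\<^esub> \<ominus>\<^bsub>?R\<^esub> fexp (- (- coord_weight n p q k))) ?K"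
    by (rule R.finprod_reindex[OF _ inj]) (use closed in \<open>force simp only: minus_minus\<close>)
  finally show ?thesis by (simp only: minus_minus)
qed

theorem Delta_bar_mult_ch:
  fixes n p q :: nat
  defines "R \<equiv> series_ring (n + p + q)"
  shows "Delta_bar n p q \<in> carrier R" and "ch (n + p + q) (poly_M p q) (m_action n p q) \<in> carrier R"
    and "Delta_bar n p q \<otimes>\<^bsub>R\<^esub> ch (n + p + q) (poly_M p q) (m_action n p q) = \<one>\<^bsub>R\<^esub>"
proof -
  let ?K = "{..<p} \<times> {..<q}"
  interpret graded_cone "uminus ` pos_roots (n + p + q)" "height (n + p + q)"
    by (rule graded_cone_neg_roots)
  have exp: "fexp \<xi> = exp_series \<xi>" for \<xi> by (simp add: fexp_def exp_series_def)
  have sub: "coord_weight n p q ` ?K \<subseteq> uminus ` pos_roots (n + p + q)"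
    using neg_coord_weight_roots by blast
  show "Delta_bar n p q \<in> carrier R"
    unfolding R_def Delta_bar_eq unfolding series_ring_eq exp
    by (rule series.finprod_closed) (use sub gens_in_cone factor_closed in blast)
  show "ch (n + p + q) (poly_M p q) (m_action n p q) \<in> carrier R"
    unfolding R_def ch_poly_M series_ring_eq by (rule partition_count_closed[OF sub])
  show "Delta_bar n p q \<otimes>\<^bsub>R\<^esub> ch (n + p + q) (poly_M p q) (m_action n p q) = \<one>\<^bsub>R\<^esub>"
    unfolding R_def ch_poly_M Delta_bar_eq unfolding series_ring_eq exp
    by (rule partition_count_inverse[OF _ sub]) simp
qed

theorem lemma5:
  fixes n p q :: nat
  assumes "n > 0" and "p > 0" and "q > 0"
  defines "N \<equiv> n + p + q"
  defines "R \<equiv> series_ring N"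
  defines "L \<equiv> poly_M p q"
  defines "\<rho> \<equiv> m_action n p q"
  shows "Phi_bar n p q = {eps N i - eps N (p + n + j) | i j. i < p \<and> j < q} \<and>
         lie_module (alg_m n p q) L \<rho> \<and>
         has_weight_decomposition N L \<rho> \<and>
         ch N L \<rho> \<in> Units R \<and>
         Delta_bar n p q = inv\<^bsub>R\<^esub> (ch N L \<rho>)"
proof (intro conjI)
  interpret cone: graded_cone "uminus ` pos_roots N" "height N" by (rule graded_cone_neg_roots)
  interpret R: cring R unfolding R_def series_ring_eq by (rule cone.cring_series)
  interpret basis: weight_basis N L \<rho> "{M. set_mset M \<subseteq> {..<p} \<times> {..<q}}"
    "monomial p q" "\<lambda>M. \<Sum>k\<in>#M. coord_weight n p q k"
    unfolding N_def L_def \<rho>_def by (rule weight_basis_monomials)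
  show "Phi_bar n p q = {eps N i - eps N (p + n + j) | i j. i < p \<and> j < q}"
    unfolding N_def by (rule Phi_bar_eq)
  show "lie_module (alg_m n p q) L \<rho>" unfolding L_def \<rho>_def by (rule lie_module_poly_M)
  show "has_weight_decomposition N L \<rho>" by (rule basis.weight_decomposition)
  have D: "Delta_bar n p q \<in> carrier R" and C: "ch N L \<rho> \<in> carrier R"
    and DC: "Delta_bar n p q \<otimes>\<^bsub>R\<^esub> ch N L \<rho> = \<one>\<^bsub>R\<^esub>"
    unfolding R_def N_def L_def \<rho>_def by (rule Delta_bar_mult_ch)+
  have CD: "ch N L \<rho> \<otimes>\<^bsub>R\<^esub> Delta_bar n p q = \<one>\<^bsub>R\<^esub>"
    using R.m_comm[OF C D] DC by simp
  show "ch N L \<rho> \<in> Units R" unfolding Units_def using C D DC CD by blast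
  show "Delta_bar n p q = inv\<^bsub>R\<^esub> (ch N L \<rho>)" using R.comm_inv_char[OF C D CD] ..
qed

end
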